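(* For $\tau\in\mathbb{H}^2$ let $q=e^{2\pi i\tau}$ and $$W=\theta^4\begin{bmatrix}1\\ \frac13\end{bmatrix}(0,\tau)\Big/\theta^4\begin{bmatrix}1\\ \frac23\end{bmatrix}(0,\tau).$$ Then $$W=\left\{\sqrt3\,\frac{(q^2;q^2)_\infty(q^3;q^3)_\infty^2}{(q;q)_\infty^2(q^6;q^6)_\infty}\right\}^4,$$ and $W$ satisfies the Riccati equation $$q\frac{dW}{dq}=\frac1{2^3}\left\{\frac{(q;q)_\infty^2(q^3;q^3)_\infty^2}{(q^2;q^2)_\infty(q^6;q^6)_\infty}\right\}^2\left(W^2-10W+9\right).$$
   Context: $\mathbb{H}^2$ is the upper half-plane. For $\epsilon,\epsilon'\in\mathbb{R}$, $\theta\begin{bmatrix}\epsilon\\ \epsilon'\end{bmatrix}(\zeta,\tau)=\sum_{n\in\mathbb{Z}}\exp\!\Big(2\pi i\Big[\tfrac12\big(n+\tfrac{\epsilon}{2}\big)^2\tau+\big(n+\tfrac{\epsilon}{2}\big)\big(\zeta+\tfrac{\epsilon'}{2}\big)\Big]\Big)$; $\theta^k$ is the $k$-th power. $(q^k;q^k)_\infty=\prod_{n\ge1}(1-q^{kn})$. The derivative $q\,d/dq$ is understood as $\frac{1}{2\pi i}\frac{d}{d\tau}$. *)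

theory Defs
  imports "HOL-Analysis.Analysis"
begin

definition theta_char :: "real \<Rightarrow> real \<Rightarrow> complex \<Rightarrow> complex \<Rightarrow> complex" where
  "theta_char e e' z t =
     (\<Sum>\<^sub>\<infinity> n::int. exp (2 * of_real pi * \<i> *
        ((1/2) * (of_int n + of_real (e/2))\<^sup>2 * t + (of_int n + of_real (e/2)) * (z + of_real (e'/2)))))"

definition qpoch_inf :: "complex \<Rightarrow> nat \<Rightarrow> complex" where
  "qpoch_inf q k = (\<Prod>n. 1 - q ^ (k * Suc n))"

end

(* Up to elementary factors, theta_char 1 (1/3) 0 and theta_char 1 (2/3) 0 are the values at roots of
   unity of theta x q = (x; q) (q/x; q), by the Jacobi triple product, and at the sixth roots of unity
   and at q, q^2, q^3 (with base q^6) this function is a quotient of the products E_k = (q^k; q^k).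

   The products theta (x y) theta (x / y) have rank two, so they satisfy a three-term (Pluecker)
   relation. Specialised to sixth roots of unity it gives W - 1 as a product of E_k, and combined with
   the specialisation to powers of q (base q^6) it gives the factor W - 9. Its second derivative at
   z = 1 expresses a difference of two values of the Weierstrass function as a product of theta
   values. Taken at q and w q with w^3 = 1 (base q^2), this identifies the Lambert series of the
   logarithmic derivative of W with 8 q E_2^4 E_6^4 / (E_1^2 E_3^2). *)
theory Submission
  imports Defs "HOL-Complex_Analysis.Complex_Analysis"
begin

section \<open>The Jacobi triple product\<close>

text \<open>The quadratic W^2 - 10 W + 9 is (W - 1) (W - 9). Behind both factors stands one
  function, X = E_2^3 E_3^9 / (q E_1^3 E_6^9), for which X + 1 and X - 8 are again quotients of the
  E_k up to a power of q: W = 9 X / (X - 8), so W - 1 = 8 (X + 1) / (X - 8) and W - 9 = 72 / (X -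
  8). Once the logarithmic derivative of W is a product as well, the Riccati equation only compares
  exponents and constants. The derivative is the harder half, being a sum of four Lambert series.
  The cube root of unity makes this sum a difference of Weierstrass values: for base q^2 the map x
  -> q^2 / x fixes q and exchanges w q with w^2 q, and summing over 1, w, w^2 passes from base q^2
  to base q^6. Hence the difference between q and w q is three times the combination with
  coefficients 1, -1, -3, 3 at q, q^2, q^3, q^6.\<close>

definition tri :: "int \<Rightarrow> int" where
  "tri j = (j * (j - 1)) div 2"

lemma two_tri: "2 * tri j = j * (j - 1)"
  unfolding tri_def by (simp add: dvd_div_mult_self)

lemma tri_Suc: "tri (j + 1) = tri j + j"
proof -
  have "2 * tri (j + 1) = 2 * (tri j + j)"
    unfolding distrib_left two_tri by (simp add: algebra_simps)
  thus ?thesis by simp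
qed

definition qfin :: "complex \<Rightarrow> nat \<Rightarrow> complex" where
  "qfin q n = (\<Prod>i<n. 1 - q ^ Suc i)"

text \<open>Extending the reciprocal by 0 to negative arguments makes the recurrence
  \<open>rqfin_pred\<close> hold for all integers, which removes every boundary case from the
  finite triple product.\<close>

definition rqfin :: "complex \<Rightarrow> int \<Rightarrow> complex" where
  "rqfin q k = (if k < 0 then 0 else 1 / qfin q (nat k))"

lemma one_minus_power_nonzero:
  fixes q :: complex
  assumes "norm q < 1" "n > 0"
  shows "1 - q ^ n \<noteq> 0"
proof
  assume "1 - q ^ n = 0"
  hence "norm q ^ n = 1" by (metis eq_iff_diff_eq_0 norm_one norm_power)
  moreover have "norm q ^ n < 1" using assms by (simp add: power_less_one_iff)
  ultimately show False by simp
qed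

lemma rqfin_pred:
  assumes "norm q < 1"
  shows "rqfin q (k - 1) = (1 - q powi k) * rqfin q k"
proof (cases "k > 0")
  case True
  then obtain m where m: "k = int (Suc m)" by (metis zero_less_imp_eq_int Suc_pred)
  have "1 - q ^ Suc m \<noteq> 0" using one_minus_power_nonzero[OF assms, of "Suc m"] by simp
  moreover have "nat (int (Suc m)) = Suc m" "nat (int (Suc m) - 1) = m" by simp_all
  moreover have "q powi (int (Suc m)) = q ^ Suc m" by (rule power_int_of_nat)
  ultimately show ?thesis unfolding m rqfin_def qfin_def prod.lessThan_Suc
    by (simp del: of_nat_Suc power_Suc)
next
  case False
  thus ?thesis by (cases "k = 0") (auto simp: rqfin_def)
qed

text \<open>The coefficients are the q-binomials (2n choose n + j), so this is a finite sum written
  over all integers. In the induction step the new factor (1 - x q^n) (1 - q^(n+1) / x) expands into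
  1 + q^(2n+1), - x q^n and - q^(n+1) / x; the last two shift the summation index, and the claim
  becomes a recurrence for the coefficients.\<close>

lemma finite_triple_product:
  fixes q x :: complex
  assumes q: "norm q < 1" "q \<noteq> 0" and x: "x \<noteq> 0"
  shows "((\<lambda>j. (-x) powi j * q powi tri j * (qfin q (2 * n) * rqfin q (int n - j) * rqfin q (int n + j)))
           has_sum (\<Prod>k<n. (1 - x * q ^ k) * (1 - q ^ Suc k / x))) UNIV"
proof (induction n)
  case 0
  have "((\<lambda>j. (-x) powi j * q powi tri j * (qfin q 0 * rqfin q (0 - j) * rqfin q (0 + j)))
           has_sum (\<Sum>j\<in>{0}. (-x) powi j * q powi tri j * (qfin q 0 * rqfin q (0 - j) * rqfin q (0 + j)))) {0}"
    by (rule has_sum_finite) simp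
  also have "?this \<longleftrightarrow> ((\<lambda>j. (-x) powi j * q powi tri j * (qfin q 0 * rqfin q (0 - j) * rqfin q (0 + j)))
           has_sum (\<Sum>j\<in>{0}. (-x) powi j * q powi tri j * (qfin q 0 * rqfin q (0 - j) * rqfin q (0 + j)))) UNIV"
    by (rule has_sum_cong_neutral) (auto simp: rqfin_def)
  also have "(\<Sum>j\<in>{0}. (-x) powi j * q powi tri j * (qfin q 0 * rqfin q (0 - j) * rqfin q (0 + j))) = 1"
    by (simp add: rqfin_def qfin_def tri_def)
  finally show ?case by simp
next
  case (Suc n)
  define t where "t = (\<lambda>n j. (-x) powi j * q powi tri j *
    (qfin q (2 * n) * rqfin q (int n - j) * rqfin q (int n + j)))"
  define P where "P = (\<Prod>k<n. (1 - x * q ^ k) * (1 - q ^ Suc k / x))"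
  have IH: "(t n has_sum P) UNIV" using Suc.IH by (simp add: t_def P_def)
  have up: "((\<lambda>j. t n (j + 1)) has_sum P) UNIV"
    using IH by (subst has_sum_reindex_bij_betw[of "\<lambda>j. j + 1" UNIV UNIV])
      (auto intro!: bij_betwI[of _ _ _ "\<lambda>j. j - 1"])
  have down: "((\<lambda>j. t n (j - 1)) has_sum P) UNIV"
    using IH by (subst has_sum_reindex_bij_betw[of "\<lambda>j. j - 1" UNIV UNIV])
      (auto intro!: bij_betwI[of _ _ _ "\<lambda>j. j + 1"])
  have "((\<lambda>j. (1 + q ^ (2 * n + 1)) * t n j + (- x * q ^ n) * t n (j - 1) + (- (q ^ Suc n) / x) * t n (j + 1))
      has_sum (1 + q ^ (2 * n + 1)) * P + (- x * q ^ n) * P + (- (q ^ Suc n) / x) * P) UNIV"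
    by (intro has_sum_add has_sum_cmult_right IH up down)
  also have "(1 + q ^ (2 * n + 1)) * P + (- x * q ^ n) * P + (- (q ^ Suc n) / x) * P
     = (\<Prod>k<Suc n. (1 - x * q ^ k) * (1 - q ^ Suc k / x))"
    unfolding prod.lessThan_Suc P_def[symmetric] using x
    by (simp add: field_simps mult_2_right power_add)
  also have "(\<lambda>j. (1 + q ^ (2 * n + 1)) * t n j + (- x * q ^ n) * t n (j - 1) + (- (q ^ Suc n) / x) * t n (j + 1))
      = t (Suc n)"
  proof
    fix j
    define a b where "a = q ^ n" and "b = q powi j"
    define R1 R2 where "R1 = rqfin q (int n + 1 - j)" and "R2 = rqfin q (int n + 1 + j)"
    have b: "b \<noteq> 0" using q by (simp add: b_def)
    have pw: "q powi (int n + 1 - j) = q * a / b" "q powi (int n + 1 + j) = q * a * b"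
      "q powi (int n - j) = a / b" "q powi (int n + j) = a * b"
      using q by (simp_all add: power_int_add power_int_diff a_def b_def field_simps)
    have i: "int n + 1 - j - 1 = int n - j" "int n + 1 + j - 1 = int n + j"
            "int n - j - 1 = int n - (j + 1)" "int n + j - 1 = int n + (j - 1)"
      by simp_all
    have r: "rqfin q (int n - j) = (1 - q * a / b) * R1"
            "rqfin q (int n + j) = (1 - q * a * b) * R2"
      using rqfin_pred[OF q(1), of "int n + 1 - j"] rqfin_pred[OF q(1), of "int n + 1 + j"]
      unfolding R1_def R2_def pw i by simp_all
    have r': "rqfin q (int n - (j + 1)) = (1 - a / b) * ((1 - q * a / b) * R1)"
             "rqfin q (int n + (j - 1)) = (1 - a * b) * ((1 - q * a * b) * R2)"
      using rqfin_pred[OF q(1), of "int n - j"] rqfin_pred[OF q(1), of "int n + j"]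
      unfolding r pw i by simp_all
    have r'': "rqfin q (int n - (j - 1)) = R1" "rqfin q (int n + (j + 1)) = R2"
              "rqfin q (int (Suc n) - j) = R1" "rqfin q (int (Suc n) + j) = R2"
      by (simp_all add: R1_def R2_def algebra_simps)
    define Y where "Y = (-x) powi j"
    have Y: "(-x) powi (j + 1) = Y * (-x)" "(-x) powi (j - 1) = Y / (-x)"
      using x unfolding Y_def by (subst power_int_add power_int_diff; simp)+
    define T where "T = q powi tri j"
    have T: "q powi tri (j + 1) = T * b" "q powi tri (j - 1) = T * q / b"
    proof -
      show "q powi tri (j + 1) = T * b" unfolding tri_Suc T_def b_def using q by (simp add: power_int_add)
      have "tri (j - 1) = tri j - (j - 1)" using tri_Suc[of "j - 1"] by simp
      thus "q powi tri (j - 1) = T * q / b" unfolding T_def b_def using q by (simp add: power_int_diff)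
    qed
    have Q: "qfin q (2 * Suc n) = qfin q (2 * n) * (1 - q * a\<^sup>2) * (1 - q\<^sup>2 * a\<^sup>2)"
      by (simp add: qfin_def a_def power_mult power2_eq_square power_add mult_ac)
    have pwn: "q ^ (2 * n + 1) = q * a\<^sup>2" "q ^ Suc n = q * a" "q ^ n = a"
      by (simp_all add: a_def power_mult [symmetric] mult.commute)
    \<comment> \<open>The recurrence after the factors common to all terms are removed; the left
      side is the growth of \<open>qfin q (2 * n)\<close> from n to n + 1.\<close>
    have key: "(1 - q * a\<^sup>2) * (1 - q\<^sup>2 * a\<^sup>2) =
        (1 + q * a\<^sup>2) * ((1 - q * a / b) * (1 - q * a * b))
        + (q * a / b) * ((1 - a * b) * (1 - q * a * b))
        + (q * a * b) * ((1 - a / b) * (1 - q * a / b))"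
      using b by (simp add: field_simps power2_eq_square)
    have "(1 + q * a\<^sup>2) * (Y * T * (qfin q (2 * n) * ((1 - q * a / b) * R1) * ((1 - q * a * b) * R2)))
       + (- x * a) * (Y / (-x) * (T * q / b) * (qfin q (2 * n) * R1 * ((1 - a * b) * ((1 - q * a * b) * R2))))
       + (- (q * a) / x) * (Y * (-x) * (T * b) * (qfin q (2 * n) * ((1 - a / b) * ((1 - q * a / b) * R1)) * R2))
       = Y * T * qfin q (2 * n) * R1 * R2 *
        ((1 + q * a\<^sup>2) * ((1 - q * a / b) * (1 - q * a * b))
        + (q * a / b) * ((1 - a * b) * (1 - q * a * b))
        + (q * a * b) * ((1 - a / b) * (1 - q * a / b)))"
      using x by (simp add: distrib_left mult_ac)
    also have "\<dots> = Y * T * (qfin q (2 * n) * (1 - q * a\<^sup>2) * (1 - q\<^sup>2 * a\<^sup>2) * R1 * R2)"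
      by (subst key [symmetric]) (simp add: mult_ac)
    finally show "(1 + q ^ (2 * n + 1)) * t n j + (- x * q ^ n) * t n (j - 1) + (- (q ^ Suc n) / x) * t n (j + 1)
      = t (Suc n) j"
      unfolding t_def Y T Q r r' r'' pwn Y_def[symmetric] T_def[symmetric] .
  qed
  finally show ?case by (simp add: t_def)
qed

section \<open>Infinite q-products and the limit of the finite identity\<close>

definition poch :: "complex \<Rightarrow> complex \<Rightarrow> complex" where
  "poch a Q = (\<Prod>n. 1 - a * Q ^ n)"

lemma qpoch_inf_eq_poch: "qpoch_inf q k = poch (q ^ k) (q ^ k)"
  unfolding qpoch_inf_def poch_def by (simp add: power_add power_mult)

lemma summable_norm_geometric_mult:
  fixes a Q :: complex
  assumes "norm Q < 1"
  shows "summable (\<lambda>n. norm (a * Q ^ n))"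
  using assms by (auto simp: norm_mult norm_power intro!: summable_mult summable_geometric)

lemma convergent_prod_poch:
  fixes a Q :: complex
  assumes "norm Q < 1"
  shows "convergent_prod (\<lambda>n. 1 - a * Q ^ n)"
  by (intro abs_convergent_prod_imp_convergent_prod summable_imp_abs_convergent_prod)
    (use summable_norm_geometric_mult[OF assms, of a] in simp)

lemma poch_LIMSEQ:
  assumes "norm Q < 1"
  shows "(\<lambda>n. \<Prod>k<n. 1 - a * Q ^ k) \<longlonglongrightarrow> poch a Q"
  using convergent_prod_LIMSEQ[OF convergent_prod_poch[OF assms]]
  unfolding poch_def LIMSEQ_lessThan_iff_atMost[symmetric] .

lemma poch_nonzero:
  assumes "norm Q < 1" "\<And>n. a * Q ^ n \<noteq> 1"
  shows "poch a Q \<noteq> 0"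
  unfolding poch_def using assms(2)
  by (intro prodinf_nonzero convergent_prod_poch assms(1)) (metis eq_iff_diff_eq_0)

lemma poch_nonzero':
  assumes "norm Q < 1" "norm a < 1"
  shows "poch a Q \<noteq> 0"
proof (rule poch_nonzero)
  fix n
  have "norm (a * Q ^ n) \<le> norm a * 1"
    unfolding norm_mult norm_power using assms by (intro mult_left_mono power_le_one) auto
  with assms(2) show "a * Q ^ n \<noteq> 1" by auto
qed fact

lemma qfin_LIMSEQ: "norm q < 1 \<Longrightarrow> qfin q \<longlonglongrightarrow> poch q q"
  using poch_LIMSEQ[of q q] by (simp add: qfin_def[abs_def])

lemma rqfin_LIMSEQ:
  assumes "norm q < 1"
  shows "(\<lambda>n. rqfin q (int n + c)) \<longlonglongrightarrow> 1 / poch q q"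
proof -
  have *: "(\<lambda>n. rqfin q (int n)) \<longlonglongrightarrow> 1 / poch q q"
    using tendsto_divide[OF tendsto_const qfin_LIMSEQ[OF assms] poch_nonzero'[OF assms assms], of 1]
    by (simp add: rqfin_def)
  show ?thesis
  proof (cases c rule: int_cases2)
    case (nonneg m)
    thus ?thesis using LIMSEQ_ignore_initial_segment[OF *, of m] by simp
  next
    case (nonpos m)
    show ?thesis by (rule LIMSEQ_offset[of _ m]) (use * nonpos in simp)
  qed
qed

definition theta_term :: "complex \<Rightarrow> complex \<Rightarrow> int \<Rightarrow> complex" where
  "theta_term x q j = (-x) powi j * q powi tri j"

text \<open>Ratio test on both half-lines: the quotient of neighbours is y r^n to the right and
  r^(n+2) / y to the left, and both tend to 0.\<close>

lemma summable_on_theta_real: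
  fixes r y :: real
  assumes r: "0 < r" "r < 1" and y: "y > 0"
  shows "(\<lambda>j. y powi j * r powi tri j) summable_on UNIV"
proof -
  define f where "f = (\<lambda>j. y powi j * r powi tri j)"
  have f_pos: "f j > 0" for j using assms by (simp add: f_def)
  have step: "f (j + 1) = f j * (y * r powi j)" for j
    using assms unfolding f_def tri_Suc by (simp add: power_int_add)
  have ev: "\<forall>\<^sub>F n in sequentially. r ^ n * c < 1/2" if "c > 0" for c
  proof -
    have "(\<lambda>n. r ^ n * c) \<longlonglongrightarrow> 0 * c" by (intro tendsto_intros LIMSEQ_power_zero) (use r in auto)
    thus ?thesis using order_tendstoD(2)[of _ 0 sequentially "1/2::real"] by simp
  qed
  have pos: "summable (\<lambda>n. f (int n))"
  proof -
    obtain N where N: "\<And>n. n \<ge> N \<Longrightarrow> r ^ n * y < 1/2"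
      using ev[OF y] by (auto simp: eventually_sequentially)
    show ?thesis
    proof (rule summable_ratio_test[of "1/2" N])
      fix n assume "n \<ge> N"
      have "f (int (Suc n)) = (r ^ n * y) * f (int n)" using step[of "int n"] by (simp add: add.commute)
      also have "\<dots> \<le> 1/2 * f (int n)"
        using N[OF \<open>n \<ge> N\<close>] f_pos[of "int n"] by (intro mult_right_mono) auto
      finally show "norm (f (int (Suc n))) \<le> 1/2 * norm (f (int n))"
        using f_pos[of "int n"] f_pos[of "int (Suc n)"] by simp
    qed simp
  qed
  have neg: "summable (\<lambda>n. f (- int n - 1))"
  proof -
    obtain N where N: "\<And>n. n \<ge> N \<Longrightarrow> r ^ n * (r\<^sup>2 / y) < 1/2"
      using ev[of "r\<^sup>2 / y"] y r by (auto simp: eventually_sequentially)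
    show ?thesis
    proof (rule summable_ratio_test[of "1/2" N])
      fix n assume "n \<ge> N"
      have "- int (Suc n) - 1 + 1 = - int n - 1" by simp
      with step[of "- int (Suc n) - 1"]
      have "f (- int n - 1) = f (- int (Suc n) - 1) * (y * r powi (- int (Suc n) - 1))" by metis
      also have "- int (Suc n) - 1 = - int (n + 2)" by simp
      also have "r powi (- int (n + 2)) = inverse (r ^ n * r\<^sup>2)"
        unfolding power_int_minus power_int_of_nat power_add ..
      finally have "f (- int (Suc n) - 1) = (r ^ n * (r\<^sup>2 / y)) * f (- int n - 1)"
        using r y by (simp add: field_simps)
      also have "\<dots> \<le> 1/2 * f (- int n - 1)"
        using N[OF \<open>n \<ge> N\<close>] f_pos[of "- int n - 1"] by (intro mult_right_mono) auto
      finally show "norm (f (- int (Suc n) - 1)) \<le> 1/2 * norm (f (- int n - 1))"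
        using f_pos[of "- int n - 1"] f_pos[of "- int (Suc n) - 1"] by (simp del: of_nat_Suc)
    qed simp
  qed
  have "f summable_on range int"
    by (subst summable_on_reindex) (use pos f_pos in \<open>auto simp: o_def less_imp_le summable_on_UNIV_nonneg_real_iff\<close>)
  moreover have "f summable_on range (\<lambda>n. - int n - 1)"
    by (subst summable_on_reindex) (use neg f_pos in \<open>auto simp: o_def inj_def less_imp_le summable_on_UNIV_nonneg_real_iff\<close>)
  ultimately have "f summable_on (range int \<union> range (\<lambda>n. - int n - 1))"
    by (rule summable_on_union)
  also have "range int \<union> range (\<lambda>n. - int n - 1) = UNIV"
  proof -
    have "j \<in> range int \<union> range (\<lambda>n. - int n - 1)" for j
      by (cases j rule: int_cases) auto
    thus ?thesis by blast
  qed
  finally show ?thesis by (simp add: f_def)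
qed

lemma theta_term_abs_summable:
  assumes "norm q < 1" "q \<noteq> 0" "x \<noteq> 0"
  shows "(\<lambda>j. norm (theta_term x q j)) summable_on UNIV"
  using summable_on_theta_real[of "norm q" "norm x"] assms
  by (simp add: theta_term_def norm_mult norm_power_int)

text \<open>Tannery's theorem for series over the integers, obtained by enumerating them with
  \<open>int_decode\<close>. Absolute convergence of the limit series then removes the dependence on
  the enumeration.\<close>

lemma has_sum_int_dominated_limit:
  fixes a :: "nat \<Rightarrow> int \<Rightarrow> complex"
  assumes lim: "\<And>j. (\<lambda>n. a n j) \<longlonglongrightarrow> b j"
    and bound: "\<And>n j. norm (a n j) \<le> g j"
    and g: "g summable_on UNIV"
    and A: "\<And>n. (a n has_sum A n) UNIV" "A \<longlonglongrightarrow> L"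
  shows "(b has_sum L) UNIV"
proof -
  have bij: "bij_betw int_decode UNIV UNIV" by (rule bij_int_decode)
  have gnn: "g j \<ge> 0" for j using bound[of 0 j] norm_ge_zero order_trans by blast
  have sg: "summable (\<lambda>k. g (int_decode k))"
    using g summable_on_reindex_bij_betw[OF bij, of g] by (simp add: summable_on_imp_summable)
  have nb: "norm (b j) \<le> g j" for j
    by (rule Lim_norm_ubound[OF _ lim]) (use bound in auto)
  have As: "(\<Sum>k. a n (int_decode k)) = A n" for n
    using A(1)[of n] has_sum_reindex_bij_betw[OF bij, of "a n" "A n"]
    by (simp add: has_sum_imp_sums sums_unique[symmetric])
  have "(\<lambda>n. \<Sum>k. a n (int_decode k)) \<longlonglongrightarrow> (\<Sum>k. b (int_decode k))"
    using tannerys_theorem[of "\<lambda>k n. a n (int_decode k)" "\<lambda>k. b (int_decode k)" sequentially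
        "\<lambda>k. g (int_decode k)"] lim bound sg by (auto intro!: always_eventually)
  hence L: "(\<Sum>k. b (int_decode k)) = L"
    using A(2) LIMSEQ_unique unfolding As by blast
  have "(\<lambda>j. norm (b j)) summable_on UNIV"
    by (rule summable_on_comparison_test[OF g]) (use nb in auto)
  hence "b summable_on UNIV" by (rule abs_summable_summable)
  then obtain S where S: "(b has_sum S) UNIV" by (auto simp: summable_on_def)
  hence "(\<lambda>k. b (int_decode k)) sums S"
    using has_sum_reindex_bij_betw[OF bij, of b S] by (simp add: has_sum_imp_sums)
  with L have "S = L" by (simp add: sums_iff)
  with S show ?thesis by simp
qed

definition theta :: "complex \<Rightarrow> complex \<Rightarrow> complex" where
  "theta x q = poch x q * poch (q / x) q"

text \<open>The finite identity for n to infinity: every coefficient tends to 1 / (q; q). The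
  factors \<open>qfin\<close> and \<open>rqfin\<close> converge, hence are bounded, so a constant
  multiple of the absolutely convergent theta series dominates.\<close>

theorem triple_product:
  assumes q: "norm q < 1" "q \<noteq> 0" and x: "x \<noteq> 0"
  shows "(theta_term x q has_sum poch q q * theta x q) UNIV"
proof -
  define E where "E = poch q q"
  have E: "E \<noteq> 0" unfolding E_def using q by (intro poch_nonzero')
  define a where "a = (\<lambda>n j. theta_term x q j * (qfin q (2 * n) * rqfin q (int n - j) * rqfin q (int n + j)))"
  obtain C where C: "\<And>n. norm (qfin q n) \<le> C"
    using convergent_imp_Bseq[of "qfin q"] qfin_LIMSEQ[OF q(1)] unfolding Bseq_def convergent_def by blast
  have "(\<lambda>n. rqfin q (int n)) \<longlonglongrightarrow> 1 / E"
    using rqfin_LIMSEQ[OF q(1), of 0] by (simp add: E_def)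
  then obtain D where D: "\<And>n. norm (rqfin q (int n)) \<le> D"
    using convergent_imp_Bseq[of "\<lambda>n. rqfin q (int n)"] unfolding Bseq_def convergent_def by blast
  have D0: "D \<ge> 0" using D[of 0] norm_ge_zero order_trans by blast
  have D': "norm (rqfin q k) \<le> D" for k
    by (cases "k < 0") (use D[of "nat k"] D0 in \<open>auto simp: rqfin_def\<close>)
  have "(theta_term x q has_sum E * theta x q) UNIV"
  proof (rule has_sum_cong[THEN iffD1])
    \<comment> \<open>The limit of the coefficient is kept as a product of three limits; the outer
      \<open>E\<close> compensates it to 1.\<close>
    show "((\<lambda>j. E * (theta_term x q j * (E * (1 / E) * (1 / E)))) has_sum E * theta x q) UNIV"
    proof (rule has_sum_cmult_right, rule has_sum_int_dominated_limit)
      fix j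
      have "strict_mono (\<lambda>n. 2 * n :: nat)" by (auto simp: strict_mono_def)
      from LIMSEQ_subseq_LIMSEQ[OF qfin_LIMSEQ[OF q(1)] this]
      have "(\<lambda>n. qfin q (2 * n)) \<longlonglongrightarrow> E" by (simp add: o_def E_def)
      thus "(\<lambda>n. a n j) \<longlonglongrightarrow> theta_term x q j * (E * (1 / E) * (1 / E))"
        unfolding a_def using rqfin_LIMSEQ[OF q(1), of j] rqfin_LIMSEQ[OF q(1), of "-j"]
        by (intro tendsto_intros) (simp_all add: E_def)
    next
      fix n j
      have "norm (qfin q (2 * n) * rqfin q (int n - j) * rqfin q (int n + j)) \<le> C * D * D"
        unfolding norm_mult using C[of 0] norm_ge_zero[of "qfin q 0"] D0
        by (intro mult_mono C D' mult_nonneg_nonneg norm_ge_zero) linarith+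
      thus "norm (a n j) \<le> norm (theta_term x q j) * (C * D * D)"
        unfolding a_def norm_mult[of "theta_term x q j"] by (intro mult_left_mono) auto
    next
      show "(\<lambda>j. norm (theta_term x q j) * (C * D * D)) summable_on UNIV"
        by (intro summable_on_cmult_left theta_term_abs_summable assms)
    next
      fix n
      show "(a n has_sum (\<Prod>k<n. (1 - x * q ^ k) * (1 - q ^ Suc k / x))) UNIV"
        using finite_triple_product[OF assms, of n] by (simp add: a_def theta_term_def)
    next
      show "(\<lambda>n. \<Prod>k<n. (1 - x * q ^ k) * (1 - q ^ Suc k / x)) \<longlonglongrightarrow> theta x q"
        using tendsto_mult[OF poch_LIMSEQ[OF q(1), of x] poch_LIMSEQ[OF q(1), of "q / x"]]
        by (simp add: theta_def prod.distrib)
    qed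
  qed (use E in auto)
  thus ?thesis by (simp add: E_def)
qed

lemma theta_term_infsum:
  assumes "norm q < 1" "q \<noteq> 0" "x \<noteq> 0"
  shows "infsum (theta_term x q) UNIV = poch q q * theta x q"
  using triple_product[OF assms] by (rule infsumI)

section \<open>The three-term relation\<close>

lemma infsum_UNIV_times:
  fixes f g :: "'a \<Rightarrow> complex"
  assumes "(\<lambda>(i, j). f i * g j) summable_on UNIV"
  shows "infsum (\<lambda>(i, j). f i * g j) UNIV = infsum f UNIV * infsum g UNIV"
proof -
  have "infsum (\<lambda>(i, j). f i * g j) (UNIV \<times> UNIV) = (\<Sum>\<^sub>\<infinity>i. \<Sum>\<^sub>\<infinity>j. f i * g j)"
    using assms by (subst infsum_Sigma'_banach) simp_all
  also have "\<dots> = infsum f UNIV * infsum g UNIV"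
    by (simp add: infsum_cmult_right' infsum_cmult_left')
  finally show ?thesis by simp
qed

lemma power_int_add_mult_diff:
  fixes u v :: complex
  assumes "u \<noteq> 0" "v \<noteq> 0"
  shows "u powi (i + j) * v powi (i - j) = (u * v) powi i * (u / v) powi j"
  using assms by (simp add: power_int_add power_int_diff power_int_mult_distrib power_int_divide_distrib)

text \<open>For x = exp (i z) this is Jacobi's theta_3 with nome q, and \<open>thetaD\<close> is
  q^(-1/4) times theta_2. Dropping that power keeps all exponents integral.\<close>

definition thetaB :: "complex \<Rightarrow> complex \<Rightarrow> complex" where
  "thetaB q x = (\<Sum>\<^sub>\<infinity>j::int. x powi (2 * j) * q powi (j * j))"

definition thetaD :: "complex \<Rightarrow> complex \<Rightarrow> complex" where
  "thetaD q x = (\<Sum>\<^sub>\<infinity>j::int. x powi (2 * j - 1) * q powi (j * j - j))"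

text \<open>With indices i + j and i - j the exponents of q add up to i^2 - i + j^2. No mixed term
  remains, so the variables separate.\<close>

lemma theta_product_even:
  assumes "q \<noteq> 0" "x \<noteq> 0" "y \<noteq> 0"
  shows "theta_term (x * y) q (i + j) * theta_term (x / y) q (i - j)
       = (x * (x powi (2 * i - 1) * q powi (i * i - i))) * (y powi (2 * j) * q powi (j * j))"
proof -
  have "2 * (tri (i + j) + tri (i - j)) = 2 * (i * i - i + j * j)"
    unfolding distrib_left two_tri by (simp add: algebra_simps)
  hence t: "tri (i + j) + tri (i - j) = i * i - i + j * j" by simp
  have "theta_term (x * y) q (i + j) * theta_term (x / y) q (i - j)
      = ((- (x * y)) powi (i + j) * (- (x / y)) powi (i - j)) * q powi (tri (i + j) + tri (i - j))"
    using assms by (simp add: theta_term_def power_int_add)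
  also have "(- (x * y)) powi (i + j) * (- (x / y)) powi (i - j) =
      ((- (x * y)) * (- (x / y))) powi i * ((- (x * y)) / (- (x / y))) powi j"
    using assms power_int_add_mult_diff[of "- (x * y)" "- (x / y)" i j] by simp
  also have "(- (x * y)) * (- (x / y)) = x\<^sup>2" using assms by (simp add: power2_eq_square)
  also have "(- (x * y)) / (- (x / y)) = y\<^sup>2" using assms by (simp add: power2_eq_square)
  also have "(x\<^sup>2) powi i = x * x powi (2 * i - 1)"
    using assms by (simp add: power_int_diff power_int_mult)
  also have "(y\<^sup>2) powi j = y powi (2 * j)" by (simp add: power_int_mult)
  also have "q powi (tri (i + j) + tri (i - j)) = q powi (i * i - i) * q powi (j * j)"
    unfolding t using assms by (simp add: power_int_add)
  finally show ?thesis by (simp add: mult_ac)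
qed

text \<open>The other parity class has indices i + j and i - j + 1. The exponents are now i^2 and
  j^2 - j, so the two kinds of series exchange their roles.\<close>

lemma theta_product_odd:
  assumes "q \<noteq> 0" "x \<noteq> 0" "y \<noteq> 0"
  shows "theta_term (x * y) q (i + j) * theta_term (x / y) q (i - j + 1)
       = (- x * (x powi (2 * i) * q powi (i * i))) * (y powi (2 * j - 1) * q powi (j * j - j))"
proof -
  have "2 * (tri (i + j) + tri (i - j + 1)) = 2 * (i * i + (j * j - j))"
    unfolding distrib_left two_tri by (simp add: algebra_simps)
  hence t: "tri (i + j) + tri (i - j + 1) = i * i + (j * j - j)" by simp
  have "theta_term (x * y) q (i + j) * theta_term (x / y) q (i - j + 1)
      = ((- (x * y)) powi (i + j) * (- (x / y)) powi (i - j + 1)) * q powi (tri (i + j) + tri (i - j + 1))"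
    using assms by (simp add: theta_term_def power_int_add)
  also have "(- (x * y)) powi (i + j) * (- (x / y)) powi (i - j + 1) =
      ((- (x * y)) * (- (x / y))) powi i * ((- (x * y)) / (- (x / y))) powi j * (- (x / y))"
    using assms power_int_add_mult_diff[of "- (x * y)" "- (x / y)" i j]
      power_int_add_1[of "- (x / y)" "i - j"] by simp
  also have "(- (x * y)) * (- (x / y)) = x\<^sup>2" using assms by (simp add: power2_eq_square)
  also have "(- (x * y)) / (- (x / y)) = y\<^sup>2" using assms by (simp add: power2_eq_square)
  also have "(x\<^sup>2) powi i = x powi (2 * i)" by (simp add: power_int_mult)
  also have "(y\<^sup>2) powi j = y * y powi (2 * j - 1)"
    using assms by (simp add: power_int_diff power_int_mult)
  also have "q powi (tri (i + j) + tri (i - j + 1)) = q powi (i * i) * q powi (j * j - j)"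
    unfolding t using assms by (simp add: power_int_add)
  finally show ?thesis using assms by (simp add: mult_ac)
qed

text \<open>The product of two theta series is a double series over (m, n). It is split by the
  parity of m + n; on each class the summand factors, and the two classes give the two terms of a 2
  by 2 determinant. This is the rank two statement.\<close>

lemma theta_mult_decomposition:
  assumes q: "norm q < 1" "q \<noteq> 0" and x: "x \<noteq> 0" and y: "y \<noteq> 0"
  shows "(poch q q)\<^sup>2 * theta (x * y) q * theta (x / y) q
       = x * (thetaD q x * thetaB q y - thetaB q x * thetaD q y)"
proof -
  define F where "F = (\<lambda>(m, n). theta_term (x * y) q m * theta_term (x / y) q n)"
  have "(\<lambda>p. norm (F p)) summable_on UNIV \<times> UNIV"
  proof (rule Infinite_Sum.abs_summable_on_Sigma_iff[THEN iffD2], intro conjI ballI)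
    show "(\<lambda>n. norm (F (m, n))) summable_on UNIV" for m
      unfolding F_def norm_mult prod.case
      by (intro summable_on_cmult_right theta_term_abs_summable) (use assms in auto)
    show "(\<lambda>m. norm (\<Sum>\<^sub>\<infinity>n. norm (F (m, n)))) summable_on UNIV"
      unfolding F_def norm_mult prod.case infsum_cmult_right' real_norm_def abs_mult abs_norm_cancel
      by (intro summable_on_cmult_left theta_term_abs_summable) (use assms in auto)
  qed
  hence F: "F summable_on UNIV" by (simp add: abs_summable_summable)
  define Ev Od where "Ev = {(m, n::int). even (m + n)}" and "Od = {(m, n::int). odd (m + n)}"
  have sub: "F summable_on Ev" "F summable_on Od"
    using summable_on_subset_banach[OF F] by blast+
  have bijE: "bij_betw (\<lambda>(i, j). (i + j, i - j)) UNIV Ev"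
    by (rule bij_betwI[of _ _ _ "\<lambda>(m, n). ((m + n) div 2, (m - n) div 2)"])
      (simp_all add: Ev_def split_beta prod_eq_iff, safe?, presburger+)
  have bijO: "bij_betw (\<lambda>(i, j). (i + j, i - j + 1)) UNIV Od"
    by (rule bij_betwI[of _ _ _ "\<lambda>(m, n). ((m + n) div 2, (m - n + 1) div 2)"])
      (simp_all add: Od_def split_beta prod_eq_iff, safe?, presburger+)
  define A B C D where "A = (\<lambda>i::int. x * (x powi (2 * i - 1) * q powi (i * i - i)))"
    and "B = (\<lambda>j::int. y powi (2 * j) * q powi (j * j))"
    and "C = (\<lambda>i::int. - x * (x powi (2 * i) * q powi (i * i)))"
    and "D = (\<lambda>j::int. y powi (2 * j - 1) * q powi (j * j - j))"
  have FE: "(\<lambda>p. F ((\<lambda>(i, j). (i + j, i - j)) p)) = (\<lambda>(i, j). A i * B j)"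
    using theta_product_even[OF q(2) x y] by (auto simp: fun_eq_iff F_def A_def B_def)
  have FO: "(\<lambda>p. F ((\<lambda>(i, j). (i + j, i - j + 1)) p)) = (\<lambda>(i, j). C i * D j)"
    using theta_product_odd[OF q(2) x y] by (auto simp: fun_eq_iff F_def C_def D_def)
  have "infsum F Ev = infsum A UNIV * infsum B UNIV"
    using infsum_reindex_bij_betw[OF bijE, of F] summable_on_reindex_bij_betw[OF bijE, of F] sub(1)
    unfolding FE by (simp add: infsum_UNIV_times)
  moreover have "infsum F Od = infsum C UNIV * infsum D UNIV"
    using infsum_reindex_bij_betw[OF bijO, of F] summable_on_reindex_bij_betw[OF bijO, of F] sub(2)
    unfolding FO by (simp add: infsum_UNIV_times)
  moreover have "infsum F (Ev \<union> Od) = infsum F Ev + infsum F Od"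
    by (rule infsum_Un_disjoint[OF sub]) (auto simp: Ev_def Od_def)
  moreover have "Ev \<union> Od = UNIV" by (auto simp: Ev_def Od_def)
  moreover have "infsum F UNIV = (poch q q * theta (x * y) q) * (poch q q * theta (x / y) q)"
    using infsum_UNIV_times[of "theta_term (x * y) q" "theta_term (x / y) q"] F assms
    by (simp add: F_def theta_term_infsum)
  moreover have "infsum A UNIV = x * thetaD q x" "infsum B UNIV = thetaB q y"
    "infsum C UNIV = - x * thetaB q x" "infsum D UNIV = thetaD q y"
    by (simp_all only: A_def B_def C_def D_def thetaB_def thetaD_def infsum_cmult_right')
  ultimately show ?thesis by (simp add: algebra_simps power2_eq_square)
qed

text \<open>The Pluecker relation for the vectors \<open>(thetaD, thetaB)\<close> at \<open>x\<close>, \<open>y\<close>, \<open>z\<close> and 1.\<close>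

theorem theta_three_term:
  assumes q: "norm q < 1" "q \<noteq> 0" and x: "x \<noteq> 0" and y: "y \<noteq> 0" and z: "z \<noteq> 0"
  shows "y * (theta (x * y) q * theta (x / y) q * (theta z q)\<^sup>2)
       + z * (theta (y * z) q * theta (y / z) q * (theta x q)\<^sup>2)
       + x * (theta (z * x) q * theta (z / x) q * (theta y q)\<^sup>2) = 0"
proof -
  define E where "E = poch q q"
  have E: "E \<noteq> 0" unfolding E_def using q by (intro poch_nonzero')
  define br where "br = (\<lambda>x y. thetaD q x * thetaB q y - thetaB q x * thetaD q y)"
  have br: "theta (x * y) q * theta (x / y) q = x * br x y / E\<^sup>2" if "x \<noteq> 0" "y \<noteq> 0" for x y
    using theta_mult_decomposition[OF q that] E by (simp add: br_def E_def field_simps)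
  \<comment> \<open>The fourth point 1 is what produces the squares in the relation.\<close>
  have br1: "(theta x q)\<^sup>2 = x * br x 1 / E\<^sup>2" if "x \<noteq> 0" for x
    using br[OF that, of 1] by (simp add: power2_eq_square)
  have "br x y * br z 1 + br y z * br x 1 + br z x * br y 1 = 0"
    by (simp add: br_def algebra_simps)
  hence "x * y * z * (br x y * br z 1 + br y z * br x 1 + br z x * br y 1) / (E\<^sup>2 * E\<^sup>2) = 0" by simp
  thus ?thesis
    unfolding br[OF x y] br[OF y z] br[OF z x] br1[OF x] br1[OF y] br1[OF z]
    by (simp add: algebra_simps add_divide_distrib)
qed

section \<open>Theta values as quotients of infinite products\<close>

lemma poch_LIMSEQ_mult:
  assumes "norm Q < 1" "m > 0"
  shows "(\<lambda>n. \<Prod>k<m * n. 1 - a * Q ^ k) \<longlonglongrightarrow> poch a Q"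
proof -
  have "strict_mono (\<lambda>n. m * n)" using assms by (auto simp: strict_mono_def)
  from LIMSEQ_subseq_LIMSEQ[OF poch_LIMSEQ[OF assms(1)] this] show ?thesis by (simp add: o_def)
qed

lemma norm_power_less_one:
  fixes Q :: complex
  shows "norm Q < 1 \<Longrightarrow> m > 0 \<Longrightarrow> norm (Q ^ m) < 1"
  by (simp add: norm_power power_less_one_iff)

lemma poch_rec:
  assumes "norm Q < 1"
  shows "poch a Q = (1 - a) * poch (a * Q) Q"
proof (rule LIMSEQ_unique)
  show "(\<lambda>n. \<Prod>k<Suc n. 1 - a * Q ^ k) \<longlonglongrightarrow> poch a Q"
    using poch_LIMSEQ[OF assms] by (rule LIMSEQ_Suc)
  show "(\<lambda>n. \<Prod>k<Suc n. 1 - a * Q ^ k) \<longlonglongrightarrow> (1 - a) * poch (a * Q) Q"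
    unfolding prod.lessThan_Suc_shift using tendsto_mult_left[OF poch_LIMSEQ[OF assms, of "a * Q"], of "1 - a"]
    by (simp add: mult_ac)
qed

lemma poch_section2:
  assumes "norm Q < 1"
  shows "poch a (Q\<^sup>2) * poch (a * Q) (Q\<^sup>2) = poch a Q"
proof (rule LIMSEQ_unique)
  show "(\<lambda>n. \<Prod>k<2 * n. 1 - a * Q ^ k) \<longlonglongrightarrow> poch a Q"
    using assms by (rule poch_LIMSEQ_mult) simp
  have "(\<Prod>k<2 * n. 1 - a * Q ^ k) = (\<Prod>k<n. 1 - a * (Q\<^sup>2) ^ k) * (\<Prod>k<n. 1 - a * Q * (Q\<^sup>2) ^ k)" for n
    by (induction n) (simp_all add: power_mult [symmetric] mult_ac)
  thus "(\<lambda>n. \<Prod>k<2 * n. 1 - a * Q ^ k) \<longlonglongrightarrow> poch a (Q\<^sup>2) * poch (a * Q) (Q\<^sup>2)"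
    by (simp only:) (intro tendsto_mult poch_LIMSEQ norm_power_less_one assms; simp)
qed

lemma poch_section3:
  assumes "norm Q < 1"
  shows "poch a (Q ^ 3) * poch (a * Q) (Q ^ 3) * poch (a * Q\<^sup>2) (Q ^ 3) = poch a Q"
proof (rule LIMSEQ_unique)
  show "(\<lambda>n. \<Prod>k<3 * n. 1 - a * Q ^ k) \<longlonglongrightarrow> poch a Q"
    using assms by (rule poch_LIMSEQ_mult) simp
  have "(\<Prod>k<3 * n. 1 - a * Q ^ k) = (\<Prod>k<n. 1 - a * (Q ^ 3) ^ k) * (\<Prod>k<n. 1 - a * Q * (Q ^ 3) ^ k)
      * (\<Prod>k<n. 1 - a * Q\<^sup>2 * (Q ^ 3) ^ k)" for n
  proof (induction n)
    case (Suc n)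
    have e: "3 * Suc n = Suc (Suc (Suc (3 * n)))" by simp
    show ?case unfolding e prod.lessThan_Suc Suc.IH
      by (simp add: power_mult [symmetric] power2_eq_square mult_ac)
  qed simp
  thus "(\<lambda>n. \<Prod>k<3 * n. 1 - a * Q ^ k) \<longlonglongrightarrow>
      poch a (Q ^ 3) * poch (a * Q) (Q ^ 3) * poch (a * Q\<^sup>2) (Q ^ 3)"
    by (simp only:) (intro tendsto_mult poch_LIMSEQ norm_power_less_one assms; simp)
qed

lemma poch_mult_minus:
  assumes "norm Q < 1"
  shows "poch a Q * poch (- a) Q = poch (a\<^sup>2) (Q\<^sup>2)"
proof (rule LIMSEQ_unique)
  show "(\<lambda>n. (\<Prod>k<n. 1 - a * Q ^ k) * (\<Prod>k<n. 1 - (- a) * Q ^ k)) \<longlonglongrightarrow> poch a Q * poch (- a) Q"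
    by (intro tendsto_mult poch_LIMSEQ assms)
  have "(\<Prod>k<n. 1 - a * Q ^ k) * (\<Prod>k<n. 1 - (- a) * Q ^ k) = (\<Prod>k<n. 1 - a\<^sup>2 * (Q\<^sup>2) ^ k)" for n
    unfolding prod.distrib[symmetric]
    by (intro prod.cong refl) (simp add: algebra_simps power2_eq_square power_mult_distrib)
  thus "(\<lambda>n. (\<Prod>k<n. 1 - a * Q ^ k) * (\<Prod>k<n. 1 - (- a) * Q ^ k)) \<longlonglongrightarrow> poch (a\<^sup>2) (Q\<^sup>2)"
    by (simp only:) (intro poch_LIMSEQ norm_power_less_one assms; simp)
qed

lemma cube_root_unity:
  fixes w :: complex
  assumes "w\<^sup>2 + w + 1 = 0"
  shows "w\<^sup>2 = - w - 1" "w * w = - w - 1" "w ^ 3 = 1" "w \<noteq> 0" "norm w = 1" "1 / w = w\<^sup>2"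
proof -
  show sq: "w\<^sup>2 = - w - 1" using assms by (simp add: algebra_simps eq_neg_iff_add_eq_0)
  thus "w * w = - w - 1" by (simp add: power2_eq_square)
  show w3: "w ^ 3 = 1"
  proof -
    have "w ^ 3 - 1 = (w - 1) * (w\<^sup>2 + w + 1)" by (simp add: algebra_simps power2_eq_square power3_eq_cube)
    thus ?thesis using assms by simp
  qed
  show "w \<noteq> 0" using w3 by auto
  have "norm w ^ 3 = 1" using w3 by (metis norm_one norm_power)
  thus "norm w = 1" using power_eq_imp_eq_base[of "norm w" 3 1] by simp
  show "1 / w = w\<^sup>2" using w3 \<open>w \<noteq> 0\<close> by (simp add: field_simps power2_eq_square power3_eq_cube)
qed

lemma poch_mult_cube:
  assumes "norm Q < 1" and w: "w\<^sup>2 + w + 1 = 0"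
  shows "poch a Q * poch (w * a) Q * poch (w\<^sup>2 * a) Q = poch (a ^ 3) (Q ^ 3)"
proof (rule LIMSEQ_unique)
  let ?P = "\<lambda>a n. \<Prod>k<n. 1 - a * Q ^ k"
  show "(\<lambda>n. ?P a n * ?P (w * a) n * ?P (w\<^sup>2 * a) n) \<longlonglongrightarrow> poch a Q * poch (w * a) Q * poch (w\<^sup>2 * a) Q"
    by (intro tendsto_mult poch_LIMSEQ assms)
  have fac: "(1 - u) * (1 - w * u) * (1 - w\<^sup>2 * u) = 1 - u ^ 3" for u
  proof -
    have "(1 - u) * (1 - w * u) * (1 - w\<^sup>2 * u)
        = 1 - (w\<^sup>2 + w + 1) * u + w * (w\<^sup>2 + w + 1) * u\<^sup>2 - w ^ 3 * u ^ 3"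
      by (simp add: algebra_simps power2_eq_square power3_eq_cube)
    thus ?thesis using w cube_root_unity(3)[OF w] by simp
  qed
  have "?P a n * ?P (w * a) n * ?P (w\<^sup>2 * a) n = (\<Prod>k<n. 1 - a ^ 3 * (Q ^ 3) ^ k)" for n
    unfolding prod.distrib[symmetric]
  proof (intro prod.cong refl)
    fix k
    have "(Q ^ 3) ^ k = (Q ^ k) ^ 3" by (simp add: power_mult [symmetric] mult.commute)
    thus "(1 - a * Q ^ k) * (1 - w * a * Q ^ k) * (1 - w\<^sup>2 * a * Q ^ k) = 1 - a ^ 3 * (Q ^ 3) ^ k"
      using fac[of "a * Q ^ k"] by (simp add: mult.assoc power_mult_distrib)
  qed
  thus "(\<lambda>n. ?P a n * ?P (w * a) n * ?P (w\<^sup>2 * a) n) \<longlonglongrightarrow> poch (a ^ 3) (Q ^ 3)"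
    by (simp only:) (intro poch_LIMSEQ norm_power_less_one assms; simp)
qed

text \<open>Isolates the zero at x = 1. The remaining pair of products is what combines over roots
  of unity and what gives the derivative at 1.\<close>

lemma theta_eq_one_minus_mult:
  assumes "norm q < 1"
  shows "theta x q = (1 - x) * (poch (x * q) q * poch (q / x) q)"
  unfolding theta_def by (subst poch_rec[OF assms]) simp

lemma theta_inverse:
  assumes "norm q < 1" "x \<noteq> 0"
  shows "theta (1 / x) q = - theta x q / x"
  unfolding theta_eq_one_minus_mult[OF assms(1)] using assms(2) by (simp add: field_simps)

lemma theta_reflect: "q \<noteq> 0 \<Longrightarrow> x \<noteq> 0 \<Longrightarrow> theta (q / x) q = theta x q"
  by (simp add: theta_def)

lemma theta_shift:
  assumes "norm q < 1" "q \<noteq> 0" "x \<noteq> 0"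
  shows "theta (q * x) q = - theta x q / x"
  using theta_reflect[of q "1 / x"] theta_inverse[of q x] assms by simp

lemma poch_self_nonzero:
  assumes "norm q < 1" "m > 0"
  shows "poch (q ^ m) (q ^ m) \<noteq> 0"
  by (intro poch_nonzero' norm_power_less_one assms)

section \<open>Theta values at powers of q and at sixth roots of unity\<close>

context
  fixes q :: complex and E1 E2 E3 E6 :: complex
  assumes q: "norm q < 1" "q \<noteq> 0"
  defines "E1 \<equiv> poch q q" and "E2 \<equiv> poch (q\<^sup>2) (q\<^sup>2)" and "E3 \<equiv> poch (q ^ 3) (q ^ 3)"
    and "E6 \<equiv> poch (q ^ 6) (q ^ 6)"
begin

lemma E_nonzero: "E1 \<noteq> 0" "E2 \<noteq> 0" "E3 \<noteq> 0" "E6 \<noteq> 0"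
  using poch_self_nonzero[OF q(1), of 1] poch_self_nonzero[OF q(1), of 2]
    poch_self_nonzero[OF q(1), of 3] poch_self_nonzero[OF q(1), of 6]
  by (simp_all add: E1_def E2_def E3_def E6_def)

lemma norm_q_powers: "norm (q\<^sup>2) < 1" "norm (q ^ 3) < 1" "norm (q ^ 6) < 1"
  by (intro norm_power_less_one q; simp)+

lemma poch_minus_q: "poch (- q) q = E2 / E1"
  using poch_mult_minus[OF q(1), of q] E_nonzero by (simp add: E1_def E2_def field_simps)

lemma poch_minus_q3: "poch (- (q ^ 3)) (q ^ 3) = E6 / E3"
  using poch_mult_minus[OF norm_q_powers(2), of "q ^ 3"] E_nonzero
  by (simp add: E3_def E6_def field_simps flip: power_mult)

lemma poch_odd: "poch q (q\<^sup>2) = E1 / E2"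
  using poch_section2[OF q(1), of q] E_nonzero by (simp add: E1_def E2_def field_simps power2_eq_square)

lemma poch_odd3: "poch (q ^ 3) (q ^ 6) = E3 / E6"
  using poch_section2[OF norm_q_powers(2), of "q ^ 3"] E_nonzero
  by (simp add: E3_def E6_def field_simps flip: power_mult power_add)

lemma theta_minus_one: "theta (- 1) q = 2 * (E2 / E1)\<^sup>2"
  using theta_eq_one_minus_mult[OF q(1), of "- 1"] by (simp add: poch_minus_q power2_eq_square)

text \<open>Modulo 6 the odd exponents are 1, 3 and 5. The classes 1 and 5 form the theta value, so
  it is (q; q^2) without the class 3.\<close>

lemma theta6_q: "theta q (q ^ 6) = E1 * E6 / (E2 * E3)"
proof -
  have "poch q (q ^ 6) * poch (q ^ 3) (q ^ 6) * poch (q ^ 5) (q ^ 6) = E1 / E2"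
    using poch_section3[OF norm_q_powers(1), of q] unfolding poch_odd
    by (simp flip: power_mult power_Suc)
  moreover have "q ^ 6 / q = q ^ 5" using q by (simp add: eval_nat_numeral)
  ultimately show ?thesis
    unfolding theta_def poch_odd3 using E_nonzero by (simp add: field_simps)
qed

lemma theta6_q2: "theta (q\<^sup>2) (q ^ 6) = E2 / E6"
proof -
  have "poch (q\<^sup>2) (q ^ 6) * poch (q ^ 4) (q ^ 6) * poch (q ^ 6) (q ^ 6) = E2"
    using poch_section3[OF norm_q_powers(1), of "q\<^sup>2"] unfolding E2_def
    by (simp flip: power_mult power_add)
  moreover have "q ^ 6 / q\<^sup>2 = q ^ 4" using q by (simp add: eval_nat_numeral)
  ultimately show ?thesis
    unfolding theta_def using E_nonzero(4) by (simp add: E6_def field_simps)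
qed

lemma theta6_q3: "theta (q ^ 3) (q ^ 6) = (E3 / E6)\<^sup>2"
proof -
  have "q ^ 6 / q ^ 3 = q ^ 3" using q by (simp add: eval_nat_numeral)
  thus ?thesis unfolding theta_def by (simp add: poch_odd3 power2_eq_square)
qed

text \<open>The three-term relation at (q^3, q^2, q) with base q^6. All products and quotients of
  these arguments return to q, q^2, q^3 by reflection x -> q^6 / x and inversion, so only three
  theta values occur.\<close>

lemma level6_identity_powers_of_q:
  "(E2 / E6) ^ 4 = q * (E1 * E6 / (E2 * E3)) ^ 4 + E1 * E6 / (E2 * E3) * (E3 / E6) ^ 6"
proof -
  define A B C where "A = E1 * E6 / (E2 * E3)" and "B = E2 / E6" and "C = (E3 / E6)\<^sup>2"
  have th: "theta q (q ^ 6) = A" "theta (q\<^sup>2) (q ^ 6) = B" "theta (q ^ 3) (q ^ 6) = C"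
    using theta6_q theta6_q2 theta6_q3 by (simp_all add: A_def B_def C_def)
  have d: "q ^ 6 / q = q ^ 5" "q ^ 6 / q\<^sup>2 = q ^ 4" "q ^ 3 * q\<^sup>2 = q ^ 5" "q ^ 3 / q\<^sup>2 = q"
    "q\<^sup>2 * q = q ^ 3" "q\<^sup>2 / q = q" "q * q ^ 3 = q ^ 4" "q / q ^ 3 = 1 / q\<^sup>2"
    using q by (simp_all add: eval_nat_numeral)
  have th5: "theta (q ^ 5) (q ^ 6) = A"
    using theta_reflect[of "q ^ 6" q] q unfolding d th by simp
  have th4: "theta (q ^ 4) (q ^ 6) = B"
    using theta_reflect[of "q ^ 6" "q\<^sup>2"] q unfolding d th by simp
  have thm2: "theta (1 / q\<^sup>2) (q ^ 6) = - B / q\<^sup>2"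
    using theta_inverse[OF norm_q_powers(3), of "q\<^sup>2"] q unfolding th by simp
  have "q\<^sup>2 * (theta (q ^ 3 * q\<^sup>2) (q ^ 6) * theta (q ^ 3 / q\<^sup>2) (q ^ 6) * (theta q (q ^ 6))\<^sup>2)
      + q * (theta (q\<^sup>2 * q) (q ^ 6) * theta (q\<^sup>2 / q) (q ^ 6) * (theta (q ^ 3) (q ^ 6))\<^sup>2)
      + q ^ 3 * (theta (q * q ^ 3) (q ^ 6) * theta (q / q ^ 3) (q ^ 6) * (theta (q\<^sup>2) (q ^ 6))\<^sup>2) = 0"
    using q norm_q_powers by (intro theta_three_term) auto
  hence "q\<^sup>2 * (A * A * A\<^sup>2) + q * (C * A * C\<^sup>2) + q ^ 3 * (B * (- B / q\<^sup>2) * B\<^sup>2) = 0"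
    unfolding d th th5 th4 thm2 .
  hence "q * (q * A ^ 4 + A * C ^ 3 - B ^ 4) = 0"
    using q by (simp add: field_simps eval_nat_numeral)
  hence "q * A ^ 4 + A * C ^ 3 - B ^ 4 = 0" using q by simp
  hence "B ^ 4 = q * A ^ 4 + A * C ^ 3" by (simp add: algebra_simps)
  thus ?thesis by (simp add: A_def B_def C_def flip: power_mult)
qed

lemma theta2_q: "theta q (q\<^sup>2) = (E1 / E2)\<^sup>2"
proof -
  have "q\<^sup>2 / q = q" using q by (simp add: power2_eq_square)
  thus ?thesis unfolding theta_def by (simp add: poch_odd power2_eq_square[of "E1 / E2"])
qed

context
  fixes w :: complex
  assumes w: "w\<^sup>2 + w + 1 = 0"
begin

lemma theta_cube_root: "theta w q = (1 - w) * (E3 / E1)"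
proof -
  have "q / w = w\<^sup>2 * q" using cube_root_unity(6)[OF w] by (simp add: divide_inverse)
  moreover have "poch (w * q) q * poch (w\<^sup>2 * q) q = E3 / E1"
    using poch_mult_cube[OF q(1) w, of q] E_nonzero(1) by (simp add: E1_def E3_def field_simps)
  ultimately show ?thesis
    using theta_eq_one_minus_mult[OF q(1), of w] by simp
qed

text \<open>Here - w^2 is a primitive sixth root of unity. The products at - q, - w q and - w^2 q
  multiply to the one at - q^3 with base q^3; dividing by the first leaves the pair in the theta
  value.\<close>

lemma theta_sixth_root: "theta (- (w\<^sup>2)) q = - w * (E1 * E6 / (E2 * E3))"
proof -
  have i: "1 / w\<^sup>2 = w" using cube_root_unity[OF w] by (metis div_by_1 divide_divide_eq_right mult_1)
  have "poch (- q) q * (poch (- (w * q)) q * poch (- (w\<^sup>2 * q)) q) = E6 / E3"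
    using poch_mult_cube[OF q(1) w, of "- q"] by (simp add: poch_minus_q3 mult_ac)
  hence "poch (- (w * q)) q * poch (- (w\<^sup>2 * q)) q = E1 * E6 / (E2 * E3)"
    unfolding poch_minus_q using E_nonzero by (simp add: field_simps)
  moreover have "q / (- (w\<^sup>2)) = - (w * q)" using i by (simp add: divide_inverse)
  moreover have "1 - (- (w\<^sup>2)) = - w" using cube_root_unity(1)[OF w] by simp
  ultimately show ?thesis
    using theta_eq_one_minus_mult[OF q(1), of "- (w\<^sup>2)"] by (simp add: mult_ac)
qed

text \<open>The three-term relation at (-1, w, - w^2), a set closed under the needed quotients up to
  inversion. The 9 comes from (1 - w)^4 = 9 w^2, the 8 from the third power of the factor 2 in
  \<open>theta (- 1) q\<close>. Divided by (E1 E6 / (E2 E3))^4 it expresses W - 1.\<close>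

lemma level6_identity_roots_of_unity:
  "9 * (E3 / E1) ^ 4 = (E1 * E6 / (E2 * E3)) ^ 4 + 8 * (E1 * E6 / (E2 * E3)) * (E2 / E1) ^ 6"
proof -
  note W = cube_root_unity[OF w]
  define A B C where "A = E1 * E6 / (E2 * E3)" and "B = E3 / E1" and "C = (E2 / E1)\<^sup>2"
  have th: "theta (- (w\<^sup>2)) q = - w * A" "theta w q = (1 - w) * B" "theta (- 1) q = 2 * C"
    using theta_sixth_root theta_cube_root theta_minus_one by (simp_all add: A_def B_def C_def)
  have w4: "w\<^sup>2 * w\<^sup>2 = w" "w * w\<^sup>2 = 1"
  proof -
    have "w\<^sup>2 * w\<^sup>2 = w ^ 3 * w" "w * w\<^sup>2 = w ^ 3" by (simp_all add: eval_nat_numeral)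
    thus "w\<^sup>2 * w\<^sup>2 = w" "w * w\<^sup>2 = 1" unfolding W(3) by simp_all
  qed
  have inv: "- 1 / w = - (w\<^sup>2)" "1 / (- (w\<^sup>2)) = - w" "w / (- (w\<^sup>2)) = - (w\<^sup>2)"
    using W(4) w4 by (simp_all add: field_simps power2_eq_square)
  have th1: "theta (- w) q = - A / w"
    using theta_inverse[OF q(1), of "- (w\<^sup>2)"] W(4) unfolding inv(2) th by (simp add: field_simps power2_eq_square)
  have th2: "theta (w\<^sup>2) q = - (1 - w) * B / w"
    using theta_inverse[OF q(1) W(4)] unfolding W(6) th by (simp add: field_simps)
  have "w * (theta (-1 * w) q * theta (-1 / w) q * (theta (- (w\<^sup>2)) q)\<^sup>2)
      + (- (w\<^sup>2)) * (theta (w * (- (w\<^sup>2))) q * theta (w / (- (w\<^sup>2))) q * (theta (-1) q)\<^sup>2)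
      + (-1) * (theta ((- (w\<^sup>2)) * (-1)) q * theta ((- (w\<^sup>2)) / (-1)) q * (theta w q)\<^sup>2) = 0"
    using W(4) q by (intro theta_three_term) auto
  moreover have e: "w * (- (w\<^sup>2)) = -1" "-1 * w = - w" "(- (w\<^sup>2)) * (-1) = w\<^sup>2" "(- (w\<^sup>2)) / (-1) = w\<^sup>2"
    using w4 by simp_all
  ultimately have "w * (- A / w * (- w * A) * (- w * A)\<^sup>2) + (- (w\<^sup>2)) * (2 * C * (- w * A) * (2 * C)\<^sup>2)
      - (- (1 - w) * B / w) * (- (1 - w) * B / w) * ((1 - w) * B)\<^sup>2 = 0"
    unfolding e inv th th1 th2 by simp
  hence "w ^ 3 * A ^ 4 + 8 * w ^ 3 * A * C ^ 3 - ((1 - w)\<^sup>2)\<^sup>2 / w\<^sup>2 * B ^ 4 = 0"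
    using W(4) by (simp add: field_simps eval_nat_numeral)
  moreover have "((1 - w)\<^sup>2)\<^sup>2 = 9 * w\<^sup>2"
  proof -
    have "(1 - w)\<^sup>2 = - 3 * w" using W(1) by (simp add: power2_diff)
    thus ?thesis by (simp add: power_mult_distrib)
  qed
  ultimately have "A ^ 4 + 8 * A * C ^ 3 - 9 * B ^ 4 = 0" using W(3,4) by simp
  thus ?thesis by (simp add: A_def B_def C_def flip: power_mult)
qed

text \<open>The products at q, w q and w^2 q with base q^2 multiply to (q^3; q^6); dividing by the
  first leaves the theta value.\<close>

lemma theta2_wq: "theta (w * q) (q\<^sup>2) = E2 * E3 / (E1 * E6)"
proof -
  have "q\<^sup>2 / (w * q) = w\<^sup>2 * q"
    using cube_root_unity(4,6)[OF w] q by (simp add: power2_eq_square divide_simps) (simp add: mult_ac)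
  moreover have "poch q (q\<^sup>2) * poch (w * q) (q\<^sup>2) * poch (w\<^sup>2 * q) (q\<^sup>2) = E3 / E6"
    using poch_mult_cube[OF norm_q_powers(1) w, of q] poch_odd3 by (simp flip: power_mult)
  ultimately show ?thesis
    unfolding theta_def poch_odd using E_nonzero by (simp add: field_simps)
qed

lemma theta2_w: "theta w (q\<^sup>2) = (1 - w) * (E6 / E2)"
proof -
  have "q\<^sup>2 / w = w\<^sup>2 * q\<^sup>2" using cube_root_unity(6)[OF w] by (simp add: divide_inverse)
  moreover have "poch (w * q\<^sup>2) (q\<^sup>2) * poch (w\<^sup>2 * q\<^sup>2) (q\<^sup>2) = E6 / E2"
    using poch_mult_cube[OF norm_q_powers(1) w, of "q\<^sup>2"] E_nonzero(2)
    by (simp add: E2_def E6_def field_simps flip: power_mult)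
  ultimately show ?thesis
    using theta_eq_one_minus_mult[OF norm_q_powers(1), of w] by simp
qed

text \<open>The argument w q^2 is one period away from w, so both factors are values at w up to - 1
  / w. The 3 comes from - (1 - w)^2 = 3 w.\<close>

lemma theta2_product_wq_q:
  "theta (w * q * q) (q\<^sup>2) * theta (w * q / q) (q\<^sup>2) = 3 * (E6 / E2)\<^sup>2"
proof -
  note W = cube_root_unity[OF w]
  have a: "theta (w * q * q) (q\<^sup>2) = - theta w (q\<^sup>2) / w"
    using theta_shift[OF norm_q_powers(1) _ W(4)] q by (simp add: power2_eq_square mult_ac)
  have b: "w * q / q = w" using q by simp
  have c: "- ((1 - w) * (1 - w)) = 3 * w" using W(2) by (simp add: algebra_simps)
  have "theta (w * q * q) (q\<^sup>2) * theta (w * q / q) (q\<^sup>2)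
      = - ((1 - w) * (E6 / E2)) / w * ((1 - w) * (E6 / E2))"
    unfolding a b theta2_w ..
  also have "\<dots> = - ((1 - w) * (1 - w)) / w * (E6 / E2)\<^sup>2"
    by (simp add: power2_eq_square mult_ac)
  finally show ?thesis unfolding c using W(4) by simp
qed

end

end

text \<open>Both identities become linear relations between three products, which determine W - 1
  and W - 9 as monomials. The equation is then a comparison of monomials in q and the E_k.\<close>

lemma level6_Riccati_algebra:
  fixes q E1 E2 E3 E6 :: complex
  assumes nz: "q \<noteq> 0" "E1 \<noteq> 0" "E2 \<noteq> 0" "E3 \<noteq> 0" "E6 \<noteq> 0"
    and id1: "9 * (E3 / E1) ^ 4 = (E1 * E6 / (E2 * E3)) ^ 4 + 8 * (E1 * E6 / (E2 * E3)) * (E2 / E1) ^ 6"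
    and id2: "(E2 / E6) ^ 4 = q * (E1 * E6 / (E2 * E3)) ^ 4 + E1 * E6 / (E2 * E3) * (E3 / E6) ^ 6"
  defines "W \<equiv> 9 * (E2 * E3\<^sup>2 / (E1\<^sup>2 * E6)) ^ 4"
  shows "8 * (q * E2 ^ 4 * E6 ^ 4 / (E1\<^sup>2 * E3\<^sup>2)) * W
       = 1 / 2 ^ 3 * (E1\<^sup>2 * E3\<^sup>2 / (E2 * E6))\<^sup>2 * (W\<^sup>2 - 10 * W + 9)"
proof -
  \<comment> \<open>\<open>X\<close> is a Hauptmodul of level 6. The hypotheses amount to
    \<open>Y\<close> = X + 1 and \<open>t\<close> = X - 8.\<close>
  define t X Y where "t = E1 ^ 5 * E3 / (q * E2 * E6 ^ 5)"
    and "X = E2 ^ 3 * E3 ^ 9 / (q * E1 ^ 3 * E6 ^ 9)"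
    and "Y = E2 ^ 8 * E3 ^ 4 / (q * E1 ^ 4 * E6 ^ 8)"
  have t: "t \<noteq> 0" using nz by (simp add: t_def)
  have W: "W = 9 * X / t"
    using nz by (simp add: W_def X_def t_def field_simps eval_nat_numeral)
  define A where "A = E1 * E6 / (E2 * E3)"
  have A: "A \<noteq> 0" using nz by (simp add: A_def)
  \<comment> \<open>Pulling out \<open>A ^ 4\<close>, or \<open>q * A ^ 4\<close>, turns every term
    of the two identities into a constant multiple of 1, \<open>X / t\<close>, \<open>Y / t\<close>,
    \<open>X\<close> or \<open>Y\<close>.\<close>
  have "(E3 / E1) ^ 4 = A ^ 4 * X / t" "A * (E2 / E1) ^ 6 = A ^ 4 * Y / t"
    "(E2 / E6) ^ 4 = q * A ^ 4 * Y" "A * (E3 / E6) ^ 6 = q * A ^ 4 * X"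
    using nz by (simp_all add: A_def X_def Y_def t_def field_simps eval_nat_numeral)
  hence "A ^ 4 * (9 * X / t) = A ^ 4 * (1 + 8 * Y / t)" "q * A ^ 4 * Y = q * A ^ 4 * (1 + X)"
    using id1 id2 unfolding A_def[symmetric] mult.assoc[of 8]
    by (simp_all only:) (simp_all add: algebra_simps)
  hence "9 * X / t = 1 + 8 * Y / t" and Y: "Y = 1 + X"
    using A nz unfolding mult_cancel_left by simp_all
  hence X: "9 * X - 8 * Y = t" using t by (simp add: field_simps)
  have "W\<^sup>2 - 10 * W + 9 = (W - 1) * (W - 9)" by (simp add: algebra_simps power2_eq_square)
  also have "W - 1 = 8 * Y / t" using \<open>9 * X / t = 1 + 8 * Y / t\<close> by (simp add: W)
  also have "W - 9 = 72 / t" using X Y t by (simp add: W field_simps)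
  finally have "W\<^sup>2 - 10 * W + 9 = 576 * Y / t\<^sup>2" by (simp add: power2_eq_square)
  moreover have "8 * (q * E2 ^ 4 * E6 ^ 4 / (E1\<^sup>2 * E3\<^sup>2)) * (9 * X / t) =
      1 / 2 ^ 3 * (E1\<^sup>2 * E3\<^sup>2 / (E2 * E6))\<^sup>2 * (576 * Y / t\<^sup>2)"
    using nz by (simp add: X_def Y_def t_def field_simps eval_nat_numeral)
  ultimately show ?thesis unfolding W by simp
qed

section \<open>Logarithmic derivatives of infinite products\<close>

text \<open>The M-test makes the partial products converge locally uniformly, so the product is
  holomorphic. As no factor vanishes, its logarithmic derivative is the termwise sum.\<close>

lemma has_field_derivative_prodinf:
  fixes f f' :: "nat \<Rightarrow> complex \<Rightarrow> complex"
  assumes S: "open S" "z \<in> S"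
    and der: "\<And>n x. x \<in> S \<Longrightarrow> (f n has_field_derivative f' n x) (at x)"
    and bound: "\<And>n x. x \<in> S \<Longrightarrow> norm (f n x) \<le> M n" "summable M"
    and nz: "\<And>n x. x \<in> S \<Longrightarrow> f n x \<noteq> 1"
  obtains L where "(\<lambda>n. - f' n z / (1 - f n z)) sums L"
    "((\<lambda>x. \<Prod>n. 1 - f n x) has_field_derivative (\<Prod>n. 1 - f n z) * L) (at z)"
    "(\<Prod>n. 1 - f n z) \<noteq> 0"
proof -
  define P where "P = (\<lambda>x. \<Prod>n. 1 - f n x)"
  have holo: "(\<lambda>x. 1 - f k x) holomorphic_on S" for k
    unfolding holomorphic_on_open[OF S(1)] using DERIV_diff[OF DERIV_const der] by blast
  have conv: "convergent_prod (\<lambda>n. 1 - f n x)" if "x \<in> S" for x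
    by (intro abs_convergent_prod_imp_convergent_prod summable_imp_abs_convergent_prod
        summable_comparison_test'[OF bound(2), of 0]) (use bound(1)[OF that] in simp)
  have Pnz: "P x \<noteq> 0" if "x \<in> S" for x
    unfolding P_def using nz[OF that] by (intro prodinf_nonzero conv that) auto
  \<comment> \<open>Used twice: for the holomorphy of the limit and, on an open disc, for the
    termwise logarithmic derivative.\<close>
  have unif: "uniform_limit (cball y r) (\<lambda>n x. \<Prod>k<n. 1 - f k x) P sequentially"
    if "cball y r \<subseteq> S" for y r
  proof -
    have "uniformly_convergent_on (cball y r) (\<lambda>N x. \<Prod>n<N. 1 + - f n x)"
    proof (rule uniformly_convergent_on_prod)
      show "continuous_on (cball y r) (\<lambda>x. - f n x)" for n
        by (intro continuous_on_minus DERIV_continuous_on[of _ _ "f' n"])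
          (meson der has_field_derivative_at_within subsetD that)
      show "uniformly_convergent_on (cball y r) (\<lambda>N x. \<Sum>n<N. norm (- f n x))"
        unfolding uniformly_convergent_on_def
        by (rule exI, rule Weierstrass_m_test[of _ _ M]) (use bound that in auto)
    qed auto
    hence "uniform_limit (cball y r) (\<lambda>n x. \<Prod>k<n. 1 - f k x)
        (\<lambda>x. lim (\<lambda>n. \<Prod>k<n. 1 - f k x)) sequentially"
      by (simp add: uniformly_convergent_uniform_limit_iff)
    moreover have "lim (\<lambda>n. \<Prod>k<n. 1 - f k x) = P x" if "x \<in> cball y r" for x
      unfolding P_def using nz[of x] \<open>cball y r \<subseteq> S\<close> that
      by (intro prodinf_eq_lim'[symmetric] conv) auto
    ultimately show ?thesis by (metis (mono_tags, lifting) uniform_limit_cong')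
  qed
  have ball: "\<exists>d>0. cball x d \<subseteq> S" if "x \<in> S" for x
    using S(1) that open_contains_cball by blast
  have "P holomorphic_on S"
  proof (rule holomorphic_uniform_sequence[OF S(1)])
    show "(\<lambda>x. \<Prod>k<n. 1 - f k x) holomorphic_on S" for n
      by (rule holomorphic_on_prod) (rule holo)
    show "\<exists>d>0. cball x d \<subseteq> S \<and> uniform_limit (cball x d) (\<lambda>n x. \<Prod>k<n. 1 - f k x) P sequentially"
      if "x \<in> S" for x
      using ball[OF that] unif by blast
  qed
  hence dP: "(P has_field_derivative deriv P z) (at z)"
    using S holomorphic_derivI by blast
  obtain r where r: "r > 0" "cball z r \<subseteq> S" using ball S(2) by blast
  have "(\<lambda>k. deriv (\<lambda>x. 1 - f k x) z / (1 - f k z)) sums (deriv P z / P z)"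
  proof (rule logderiv_prodinf_complex_uniform_limit)
    show "uniform_limit (ball z r) (\<lambda>n x. \<Prod>k<n. 1 - f k x) P sequentially"
      by (rule uniform_limit_on_subset[OF unif[OF r(2)]]) auto
    show "(\<lambda>x. 1 - f k x) holomorphic_on ball z r" for k
      using holo by (rule holomorphic_on_subset) (use r in auto)
  qed (use Pnz S r in auto)
  moreover have "deriv (\<lambda>x. 1 - f k x) z = - f' k z" for k
    by (rule DERIV_imp_deriv) (auto intro!: derivative_eq_intros der S)
  ultimately have "(\<lambda>k. - f' k z / (1 - f k z)) sums (deriv P z / P z)" by simp
  thus ?thesis using that[of "deriv P z / P z"] dP Pnz[OF S(2)] by (simp add: P_def)
qed

text \<open>Lets second-order coefficients be compared from explicit first derivatives near the
  point, without power series.\<close>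

lemma second_derivative_unique:
  fixes F G :: "complex \<Rightarrow> complex"
  assumes B: "open B" "z \<in> B"
    and eq: "\<And>x. x \<in> B \<Longrightarrow> F x = G x"
    and F: "\<And>x. x \<in> B \<Longrightarrow> (F has_field_derivative F1 x) (at x)" "(F1 has_field_derivative c) (at z)"
    and G: "\<And>x. x \<in> B \<Longrightarrow> (G has_field_derivative G1 x) (at x)" "(G1 has_field_derivative d) (at z)"
  shows "c = d"
proof -
  have "F1 x = G1 x" if "x \<in> B" for x
    using has_field_derivative_transform_within_open[OF F(1)[OF that] B(1) that eq] G(1)[OF that]
    by (rule DERIV_unique)
  hence "(G1 has_field_derivative c) (at z)"
    using has_field_derivative_transform_within_open[OF F(2) B] by blast
  thus ?thesis using G(2) by (rule DERIV_unique)
qed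

text \<open>One half of a sum over all integers n: u / (1 - u)^2 is invariant under u -> 1 / u, so
  the terms with negative n are those of \<open>wpsum (Q / x) Q\<close>.\<close>

definition wpsum :: "complex \<Rightarrow> complex \<Rightarrow> complex" where
  "wpsum x Q = (\<Sum>n. x * Q ^ n / (1 - x * Q ^ n)\<^sup>2)"

text \<open>The annulus |Q| < |x| < 1 in the coordinate x = exp z. There x and Q / x both lie in the
  unit disc, so theta has no zero and all series converge geometrically.\<close>

definition theta_strip :: "complex \<Rightarrow> complex set" where
  "theta_strip Q = {z. norm Q < norm (exp z) \<and> norm (exp z) < 1}"

lemma open_theta_strip: "open (theta_strip Q)"
  unfolding theta_strip_def by (intro open_Collect_conj open_Collect_less continuous_intros)

lemma norm_mult_geometric_le:
  fixes a Q :: complex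
  assumes "norm a \<le> \<rho>"
  shows "norm (a * Q ^ n) \<le> \<rho> * norm Q ^ n"
  unfolding norm_mult norm_power using assms by (intro mult_right_mono) auto

lemma norm_mult_geometric_le':
  fixes a Q :: complex
  assumes "norm a \<le> \<rho>" "norm Q < 1"
  shows "norm (a * Q ^ n) \<le> \<rho>"
proof -
  have "norm (a * Q ^ n) \<le> norm a * 1"
    unfolding norm_mult norm_power using assms by (intro mult_left_mono power_le_one) auto
  thus ?thesis using assms by simp
qed

text \<open>The parameters c and s treat all factors of theta at once: (1, 1) is the factor at exp
  z, (Q, -1) the one at Q / exp z, and (Q, 1) the one left when the zero at 1 is split off.\<close>

lemma poch_exp_has_logderiv:
  fixes c s Q :: complex
  assumes Q: "norm Q < 1" and z: "norm (c * exp (s * z)) < 1"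
  obtains L where
    "(\<lambda>n. - s * (c * exp (s * z) * Q ^ n) / (1 - c * exp (s * z) * Q ^ n)) sums L"
    "((\<lambda>x. poch (c * exp (s * x)) Q) has_field_derivative poch (c * exp (s * z)) Q * L) (at z)"
proof -
  let ?S = "{x. norm (c * exp (s * x)) < 1}"
  obtain L where "(\<lambda>n. - (s * (c * exp (s * z) * Q ^ n)) / (1 - c * exp (s * z) * Q ^ n)) sums L"
    "((\<lambda>x. \<Prod>n. 1 - c * exp (s * x) * Q ^ n) has_field_derivative (\<Prod>n. 1 - c * exp (s * z) * Q ^ n) * L) (at z)"
  proof (rule has_field_derivative_prodinf[of ?S z "\<lambda>n x. c * exp (s * x) * Q ^ n"
        "\<lambda>n x. s * (c * exp (s * x) * Q ^ n)" "\<lambda>n. norm Q ^ n"])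
    show "open ?S" by (intro open_Collect_less continuous_intros)
    show "z \<in> ?S" using z by simp
    show "((\<lambda>x. c * exp (s * x) * Q ^ n) has_field_derivative s * (c * exp (s * x) * Q ^ n)) (at x)" for n x
      by (auto intro!: derivative_eq_intros simp: mult_ac)
    show "norm (c * exp (s * x) * Q ^ n) \<le> norm Q ^ n" if "x \<in> ?S" for n x
      using norm_mult_geometric_le[of "c * exp (s * x)" 1 Q n] that by simp
    show "summable (\<lambda>n. norm Q ^ n)" using Q by (simp add: summable_geometric)
    show "c * exp (s * x) * Q ^ n \<noteq> 1" if "x \<in> ?S" for n x
    proof -
      have "norm (c * exp (s * x) * Q ^ n) < 1"
        using norm_mult_geometric_le'[OF order_refl Q, of "c * exp (s * x)" n] that by simp
      thus ?thesis by auto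
    qed
  qed (use that in blast)
  thus ?thesis using that by (simp add: poch_def)
qed

text \<open>Along u = c exp (s x) Q^n the derivative of u / (1 - u) is s u / (1 - u)^2. The work
  lies in a majorant that is uniform near z.\<close>

lemma geometric_logderiv_series_derivative:
  fixes c s Q :: complex
  assumes Q: "norm Q < 1" and z: "norm (c * exp (s * z)) < 1"
  shows "((\<lambda>x. \<Sum>n. c * exp (s * x) * Q ^ n / (1 - c * exp (s * x) * Q ^ n))
           has_field_derivative s * wpsum (c * exp (s * z)) Q) (at z)"
    and "summable (\<lambda>n. c * exp (s * z) * Q ^ n / (1 - c * exp (s * z) * Q ^ n))"
    and "summable (\<lambda>n. c * exp (s * z) * Q ^ n / (1 - c * exp (s * z) * Q ^ n)\<^sup>2)"
proof -
  \<comment> \<open>A radius strictly between the given norm and 1 keeps all denominators at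
    distance at least 1 - \<rho> from 0 on a whole neighbourhood.\<close>
  obtain \<rho> where \<rho>: "norm (c * exp (s * z)) < \<rho>" "\<rho> < 1" using z dense by blast
  have \<rho>0: "\<rho> > 0" using \<rho>(1) norm_ge_zero[of "c * exp (s * z)"] by linarith
  define S where "S = {x. norm (c * exp (s * x)) < \<rho>}"
  define h where "h = (\<lambda>n. complex_of_real (\<rho> / (1 - \<rho>) * norm Q ^ n))"
  have S: "open S" unfolding S_def by (intro open_Collect_less continuous_intros)
  have zS: "z \<in> S" using \<rho> by (simp add: S_def)
  have small: "norm (c * exp (s * x) * Q ^ n) \<le> \<rho>" if "x \<in> S" for x n
    using norm_mult_geometric_le'[of "c * exp (s * x)" \<rho> Q n] Q that by (simp add: S_def)
  have ne: "c * exp (s * x) * Q ^ n \<noteq> 1" if "x \<in> S" for x n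
    using small[OF that, of n] \<rho> by auto
  have "\<exists>g g'. \<forall>x\<in>S. (\<lambda>n. c * exp (s * x) * Q ^ n / (1 - c * exp (s * x) * Q ^ n)) sums g x
      \<and> (\<lambda>n. s * (c * exp (s * x) * Q ^ n / (1 - c * exp (s * x) * Q ^ n)\<^sup>2)) sums g' x
      \<and> (g has_field_derivative g' x) (at x)"
  proof (rule series_and_derivative_comparison_complex[OF S, where f = "\<lambda>n x. c * exp (s * x) * Q ^ n / (1 - c * exp (s * x) * Q ^ n)"
        and f' = "\<lambda>n x. s * (c * exp (s * x) * Q ^ n / (1 - c * exp (s * x) * Q ^ n)\<^sup>2)"])
    show "((\<lambda>x. c * exp (s * x) * Q ^ n / (1 - c * exp (s * x) * Q ^ n)) has_field_derivative
        s * (c * exp (s * x) * Q ^ n / (1 - c * exp (s * x) * Q ^ n)\<^sup>2)) (at x)" if "x \<in> S" for n x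
      using ne[OF that, of n]
      by (auto intro!: derivative_eq_intros simp: power2_eq_square divide_simps) (simp add: algebra_simps)
    show "\<exists>d (h :: nat \<Rightarrow> complex). 0 < d \<and> summable h \<and> range h \<subseteq> \<real>\<^sub>\<ge>\<^sub>0 \<and>
       (\<forall>\<^sub>F n in sequentially. \<forall>y\<in>ball x d \<inter> S.
          norm (c * exp (s * y) * Q ^ n / (1 - c * exp (s * y) * Q ^ n)) \<le> norm (h n))" if "x \<in> S" for x
    proof -
      have h1: "summable h" unfolding h_def summable_complex_of_real
        using Q by (intro summable_mult summable_geometric) auto
      have "h n \<in> \<real>\<^sub>\<ge>\<^sub>0" for n
        unfolding h_def nonneg_Reals_of_real_iff using \<rho> \<rho>0 by simp
      hence h2: "range h \<subseteq> \<real>\<^sub>\<ge>\<^sub>0" by blast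
      have h3: "norm (c * exp (s * y) * Q ^ n / (1 - c * exp (s * y) * Q ^ n)) \<le> norm (h n)" if y: "y \<in> S" for n y
      proof -
      have "norm (c * exp (s * y) * Q ^ n) \<le> \<rho> * norm Q ^ n"
        using y by (intro norm_mult_geometric_le) (simp add: S_def)
      moreover have "1 - \<rho> \<le> norm (1 - c * exp (s * y) * Q ^ n)"
        using small[OF y, of n] norm_triangle_ineq2[of 1 "c * exp (s * y) * Q ^ n"] by simp
      ultimately have "norm (c * exp (s * y) * Q ^ n) / norm (1 - c * exp (s * y) * Q ^ n)
          \<le> (\<rho> * norm Q ^ n) / (1 - \<rho>)"
        using \<rho> \<rho>0 by (intro frac_le) auto
      moreover have "norm (h n) = (\<rho> * norm Q ^ n) / (1 - \<rho>)"
        unfolding h_def norm_of_real using \<rho> \<rho>0 by simp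
      ultimately show ?thesis by (simp only: norm_divide)
      qed
      show ?thesis by (intro exI[of _ 1] exI[of _ h]) (use h1 h2 h3 in auto)
    qed
  qed
  then obtain g g' where g: "\<And>x. x \<in> S \<Longrightarrow> (\<lambda>n. c * exp (s * x) * Q ^ n / (1 - c * exp (s * x) * Q ^ n)) sums g x"
      "\<And>x. x \<in> S \<Longrightarrow> (\<lambda>n. s * (c * exp (s * x) * Q ^ n / (1 - c * exp (s * x) * Q ^ n)\<^sup>2)) sums g' x"
      "\<And>x. x \<in> S \<Longrightarrow> (g has_field_derivative g' x) (at x)" by blast
  show "summable (\<lambda>n. c * exp (s * z) * Q ^ n / (1 - c * exp (s * z) * Q ^ n))"
    using g(1)[OF zS] by (rule sums_summable)
  have ns: "summable (\<lambda>n. norm (c * exp (s * z) * Q ^ n / (1 - c * exp (s * z) * Q ^ n)\<^sup>2))"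
  proof (rule summable_comparison_test'[of "\<lambda>n. \<rho> / (1 - \<rho>)\<^sup>2 * norm Q ^ n" 0])
    show "summable (\<lambda>n. \<rho> / (1 - \<rho>)\<^sup>2 * norm Q ^ n)"
      using Q by (intro summable_mult summable_geometric) auto
    fix n
    have "norm (c * exp (s * z) * Q ^ n) \<le> \<rho> * norm Q ^ n"
      using zS by (intro norm_mult_geometric_le) (simp add: S_def)
    moreover have "1 - \<rho> \<le> norm (1 - c * exp (s * z) * Q ^ n)"
      using small[OF zS, of n] norm_triangle_ineq2[of 1 "c * exp (s * z) * Q ^ n"] by simp
    hence "(1 - \<rho>)\<^sup>2 \<le> (norm (1 - c * exp (s * z) * Q ^ n))\<^sup>2"
      using \<rho> by (intro power_mono) auto
    ultimately have "norm (c * exp (s * z) * Q ^ n) / (norm (1 - c * exp (s * z) * Q ^ n))\<^sup>2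
          \<le> (\<rho> * norm Q ^ n) / (1 - \<rho>)\<^sup>2"
        using \<rho> \<rho>0 by (intro frac_le) auto
    thus "norm (norm (c * exp (s * z) * Q ^ n / (1 - c * exp (s * z) * Q ^ n)\<^sup>2)) \<le> \<rho> / (1 - \<rho>)\<^sup>2 * norm Q ^ n"
      by (simp add: norm_divide norm_power)
  qed
  from summable_norm_cancel[OF ns]
  show sm: "summable (\<lambda>n. c * exp (s * z) * Q ^ n / (1 - c * exp (s * z) * Q ^ n)\<^sup>2)" .
  have "g' z = s * wpsum (c * exp (s * z)) Q"
    using sums_unique2[OF g(2)[OF zS] sums_mult[OF summable_sums[OF sm], of s]] by (simp add: wpsum_def)
  moreover have "((\<lambda>x. \<Sum>n. c * exp (s * x) * Q ^ n / (1 - c * exp (s * x) * Q ^ n))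
           has_field_derivative g' z) (at z)"
    by (rule has_field_derivative_transform_within_open[OF g(3)[OF zS] S zS])
      (use g(1) in \<open>auto simp: sums_iff\<close>)
  ultimately show "((\<lambda>x. \<Sum>n. c * exp (s * x) * Q ^ n / (1 - c * exp (s * x) * Q ^ n))
           has_field_derivative s * wpsum (c * exp (s * z)) Q) (at z)" by simp
qed

definition theta_logderiv :: "complex \<Rightarrow> complex \<Rightarrow> complex" where
  "theta_logderiv Q z = (\<Sum>n. Q * exp (- z) * Q ^ n / (1 - Q * exp (- z) * Q ^ n))
                      - (\<Sum>n. exp z * Q ^ n / (1 - exp z * Q ^ n))"

lemma theta_strip_norms:
  assumes "z \<in> theta_strip Q"
  shows "norm (exp z) < 1" "norm (Q * exp (- z)) < 1"
proof -
  show "norm (exp z) < 1" using assms by (simp add: theta_strip_def)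
  have "norm Q < norm (exp z)" using assms by (simp add: theta_strip_def)
  moreover have "norm (Q * exp (- z)) = norm Q / norm (exp z)"
    by (simp add: exp_minus norm_mult norm_inverse divide_inverse del: norm_exp_eq_Re)
  ultimately show "norm (Q * exp (- z)) < 1" by (simp del: norm_exp_eq_Re)
qed

lemma theta_exp_has_derivative:
  assumes Q: "norm Q < 1" and z: "z \<in> theta_strip Q"
  shows "((\<lambda>z. theta (exp z) Q) has_field_derivative theta (exp z) Q * theta_logderiv Q z) (at z)"
proof -
  note n = theta_strip_norms[OF z]
  obtain L1 where L1: "(\<lambda>n. - 1 * (1 * exp (1 * z) * Q ^ n) / (1 - 1 * exp (1 * z) * Q ^ n)) sums L1"
    "((\<lambda>x. poch (1 * exp (1 * x)) Q) has_field_derivative poch (1 * exp (1 * z)) Q * L1) (at z)"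
    by (rule poch_exp_has_logderiv[of Q 1 1 z]) (use Q n in auto)
  obtain L2 where L2: "(\<lambda>n. - (- 1) * (Q * exp (- 1 * z) * Q ^ n) / (1 - Q * exp (- 1 * z) * Q ^ n)) sums L2"
    "((\<lambda>x. poch (Q * exp (- 1 * x)) Q) has_field_derivative poch (Q * exp (- 1 * z)) Q * L2) (at z)"
    by (rule poch_exp_has_logderiv[of Q Q "- 1" z]) (use Q n in auto)
  have "- L1 = (\<Sum>n. exp z * Q ^ n / (1 - exp z * Q ^ n))"
    using sums_unique[OF sums_minus[OF L1(1)]] by simp
  hence "L1 = - (\<Sum>n. exp z * Q ^ n / (1 - exp z * Q ^ n))" by (metis minus_minus)
  moreover have "L2 = (\<Sum>n. Q * exp (- z) * Q ^ n / (1 - Q * exp (- z) * Q ^ n))"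
    using sums_unique[OF L2(1)] by simp
  ultimately have L: "theta_logderiv Q z = L1 + L2" by (simp add: theta_logderiv_def)
  have "theta (exp x) Q = poch (exp x) Q * poch (Q * exp (- x)) Q" for x
    by (simp add: theta_def exp_minus divide_inverse)
  moreover have "((\<lambda>x. poch (exp x) Q * poch (Q * exp (- x)) Q) has_field_derivative
      poch (exp z) Q * poch (Q * exp (- z)) Q * (L1 + L2)) (at z)"
    using DERIV_mult[OF L1(2) L2(2)] by (simp add: algebra_simps)
  ultimately show ?thesis by (simp add: L)
qed

lemma theta_logderiv_has_derivative:
  assumes Q: "norm Q < 1" and z: "z \<in> theta_strip Q"
  shows "(theta_logderiv Q has_field_derivative - (wpsum (exp z) Q + wpsum (Q / exp z) Q)) (at z)"
proof -
  note n = theta_strip_norms[OF z]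
  have a: "((\<lambda>x. \<Sum>n. exp x * Q ^ n / (1 - exp x * Q ^ n)) has_field_derivative wpsum (exp z) Q) (at z)"
    using geometric_logderiv_series_derivative(1)[of Q 1 1 z] Q n(1) by simp
  have "((\<lambda>x. \<Sum>n. Q * exp (- x) * Q ^ n / (1 - Q * exp (- x) * Q ^ n)) has_field_derivative
      - wpsum (Q * exp (- z)) Q) (at z)"
    using geometric_logderiv_series_derivative(1)[of Q Q "- 1" z] Q n(2) by simp
  from DERIV_diff[OF this a] have
    "(theta_logderiv Q has_field_derivative - wpsum (Q * exp (- z)) Q - wpsum (exp z) Q) (at z)"
    by (simp only: theta_logderiv_def[abs_def])
  moreover have "Q * exp (- z) = Q / exp z" by (simp add: exp_minus divide_inverse)
  moreover have "- wpsum (Q / exp z) Q - wpsum (exp z) Q = - (wpsum (exp z) Q + wpsum (Q / exp z) Q)"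
    by simp
  ultimately show ?thesis by (simp only:)
qed

section \<open>Differences of the Weierstrass function\<close>

text \<open>The point b = 0 is a zero of theta and lies outside the strip, so the logarithmic
  derivative is of no use there. Splitting off 1 - exp b leaves a holomorphic factor with value (Q;
  Q)^2 at 0.\<close>

lemma theta_near_one_factorization:
  assumes Q: "norm Q < 1"
  obtains u' B where "open B" "0 \<in> B"
    "\<And>b. b \<in> B \<Longrightarrow> ((\<lambda>b. theta (exp b) Q) has_field_derivative u' b) (at b)"
    "u' 0 = - (poch Q Q)\<^sup>2" "u' field_differentiable at 0"
proof -
  define B where "B = {b. norm (Q * exp b) < 1 \<and> norm (Q * exp (- b)) < 1}"
  define R where "R = (\<lambda>b. poch (Q * exp (1 * b)) Q * poch (Q * exp (- 1 * b)) Q)"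
  have B: "open B" unfolding B_def by (intro open_Collect_conj open_Collect_less continuous_intros)
  have B0: "0 \<in> B" using Q by (simp add: B_def)
  have "\<exists>D. (R has_field_derivative D) (at b)" if "b \<in> B" for b
  proof -
    have n: "norm (Q * exp (1 * b)) < 1" "norm (Q * exp (- 1 * b)) < 1"
      using that by (simp_all add: B_def)
    show ?thesis unfolding R_def
      using poch_exp_has_logderiv[OF Q n(1)] poch_exp_has_logderiv[OF Q n(2)] DERIV_mult by metis
  qed
  hence R: "R holomorphic_on B" unfolding holomorphic_on_open[OF B] by blast
  have th: "theta (exp b) Q = (1 - exp b) * R b" for b
    unfolding theta_eq_one_minus_mult[OF Q] R_def by (simp add: mult.commute exp_minus divide_inverse)
  have holo: "(\<lambda>b. theta (exp b) Q) holomorphic_on B"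
    unfolding th by (intro holomorphic_intros R)
  have "((\<lambda>b. (1 - exp b) * R b) has_field_derivative - R 0) (at 0)"
    using holomorphic_derivI[OF R B B0] by (auto intro!: derivative_eq_intros)
  hence d0: "deriv (\<lambda>b. theta (exp b) Q) 0 = - R 0" unfolding th by (rule DERIV_imp_deriv)
  show ?thesis
  proof (rule that[OF B B0])
    show "((\<lambda>b. theta (exp b) Q) has_field_derivative deriv (\<lambda>b. theta (exp b) Q) b) (at b)" if "b \<in> B" for b
      using holomorphic_derivI[OF holo B that] .
    show "deriv (\<lambda>b. theta (exp b) Q) 0 = - (poch Q Q)\<^sup>2"
      unfolding d0 by (simp add: R_def power2_eq_square)
    show "deriv (\<lambda>b. theta (exp b) Q) field_differentiable at 0"
      using holomorphic_deriv[OF holo B] B B0 holomorphic_on_imp_differentiable_at by blast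
  qed
qed

text \<open>Up to an additive constant, \<open>wpsum x Q + wpsum (Q / x) Q\<close> is the Weierstrass function at
  \<open>log x\<close>. The identity compares the coefficients of \<open>(log z)\<^sup>2\<close> in the three-term relation
  at \<open>z = 1\<close>.\<close>

theorem wpsum_difference:
  assumes Q: "norm Q < 1" "Q \<noteq> 0"
    and x: "norm Q < norm x" "norm x < 1" and y: "norm Q < norm y" "norm y < 1"
  shows "y * (poch Q Q) ^ 4 * (theta (x * y) Q * theta (x / y) Q)
       = (theta x Q)\<^sup>2 * (theta y Q)\<^sup>2 *
         ((wpsum y Q + wpsum (Q / y) Q) - (wpsum x Q + wpsum (Q / x) Q))"
proof -
  have x0: "x \<noteq> 0" and y0: "y \<noteq> 0" using x y by auto
  define a a' where "a = Ln x" and "a' = Ln y"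
  have ea: "exp a = x" "exp a' = y" using x0 y0 by (simp_all add: a_def a'_def)
  define s where "s = (\<lambda>b. theta (exp b) Q)"
  define L where "L = theta_logderiv Q"
  define P where "P = (\<lambda>x. wpsum x Q + wpsum (Q / x) Q)"
  define K where "K = y * (theta (x * y) Q * theta (x / y) Q)"
  obtain u' B where u0: "open B" "0 \<in> B"
    "\<And>b. b \<in> B \<Longrightarrow> ((\<lambda>b. theta (exp b) Q) has_field_derivative u' b) (at b)"
    "u' 0 = - (poch Q Q)\<^sup>2" "u' field_differentiable at 0"
    by (rule theta_near_one_factorization[OF Q(1)], rule that)
  note u = u0[folded s_def]
  obtain u2 where u2: "(u' has_field_derivative u2) (at 0)"
    using u(5) by (auto simp: field_differentiable_def)
  define C where "C = B \<inter> {b. a + b \<in> theta_strip Q} \<inter> {b. a - b \<in> theta_strip Q}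
      \<inter> {b. a' + b \<in> theta_strip Q} \<inter> {b. a' - b \<in> theta_strip Q}"
  have pre: "open {b. f b \<in> theta_strip Q}" if "continuous_on UNIV f" for f :: "complex \<Rightarrow> complex"
    using continuous_open_preimage[OF that open_UNIV open_theta_strip] by (simp add: vimage_def)
  have C: "open C" unfolding C_def
    by (intro open_Int u(1) pre continuous_intros)
  have C0: "0 \<in> C" using u(2) x y by (simp add: C_def theta_strip_def ea del: norm_exp_eq_Re)
  have s: "(s has_field_derivative s z * L z) (at z)" if "z \<in> theta_strip Q" for z
    unfolding s_def L_def by (rule theta_exp_has_derivative[OF Q(1) that])
  have dL: "(L has_field_derivative - P (exp z)) (at z)" if "z \<in> theta_strip Q" for z
    unfolding L_def P_def by (rule theta_logderiv_has_derivative[OF Q(1) that])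
  define h where "h = (\<lambda>a b. s (a + b) * s (a - b))"
  define l where "l = (\<lambda>a b. L (a + b) - L (a - b))"
  have dh: "(h c has_field_derivative h c b * l c b) (at b)"
    if "c + b \<in> theta_strip Q" "c - b \<in> theta_strip Q" for c b
  proof -
    have "((\<lambda>b. s (c + b)) has_field_derivative s (c + b) * L (c + b) * 1) (at b)"
      by (rule DERIV_chain'[of "\<lambda>b. c + b", OF _ s[OF that(1)]]) (auto intro!: derivative_eq_intros)
    moreover have "((\<lambda>b. s (c - b)) has_field_derivative s (c - b) * L (c - b) * (- 1)) (at b)"
      by (rule DERIV_chain'[of "\<lambda>b. c - b", OF _ s[OF that(2)]]) (auto intro!: derivative_eq_intros)
    ultimately show ?thesis
      unfolding h_def l_def using DERIV_mult by (fastforce simp: algebra_simps)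
  qed
  have dl: "(l c has_field_derivative - 2 * P (exp c)) (at 0)" if "c \<in> theta_strip Q" for c
  proof -
    have "((\<lambda>b. L (c + b)) has_field_derivative - P (exp c) * 1) (at 0)"
      by (rule DERIV_chain'[of "\<lambda>b. c + b"]) (use dL[OF that] in \<open>auto intro!: derivative_eq_intros\<close>)
    moreover have "((\<lambda>b. L (c - b)) has_field_derivative - P (exp c) * (- 1)) (at 0)"
      by (rule DERIV_chain'[of "\<lambda>b. c - b"]) (use dL[OF that] in \<open>auto intro!: derivative_eq_intros\<close>)
    ultimately show ?thesis
      unfolding l_def using DERIV_diff by fastforce
  qed
  have as: "a \<in> theta_strip Q" "a' \<in> theta_strip Q" using C0 by (simp_all add: C_def)
  have l0: "l c 0 = 0" for c by (simp add: l_def)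
  \<comment> \<open>As \<open>l c 0\<close> = 0, the product rule leaves only the value of
    \<open>h\<close> times the derivative of \<open>l\<close>.\<close>
  have dh2: "((\<lambda>b. h c b * l c b) has_field_derivative - 2 * (s c)\<^sup>2 * P (exp c)) (at 0)"
    if "c \<in> theta_strip Q" for c
    using DERIV_mult[OF dh[of c 0] dl[OF that]] that by (simp add: l0 h_def power2_eq_square mult_ac)
  have "K * (2 * (poch Q Q) ^ 4) = - 2 * (s a)\<^sup>2 * P (exp a) * (s a')\<^sup>2 - (- 2 * (s a')\<^sup>2 * P (exp a')) * (s a)\<^sup>2"
  proof (rule second_derivative_unique[OF C C0])
    fix b assume b: "b \<in> C"
    define z where "z = exp b"
    have z0: "z \<noteq> 0" by (simp add: z_def)
    have e: "exp (a + b) = x * z" "exp (a - b) = x / z" "exp (a' + b) = y * z" "exp (a' - b) = y / z"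
      by (simp_all add: exp_add exp_diff ea z_def)
    \<comment> \<open>The third product of the relation contains z / x; inversion brings it to the
      shape of the second one.\<close>
    have "theta (z / x) Q = - theta (x / z) Q * z / x"
      using theta_inverse[OF Q(1), of "x / z"] x0 z0 by simp
    with theta_three_term[OF Q x0 y0 z0]
    have "z * (theta (y * z) Q * theta (y / z) Q * (theta x Q)\<^sup>2) + K * (theta z Q)\<^sup>2
      - z * (theta (x * z) Q * theta (x / z) Q * (theta y Q)\<^sup>2) = 0"
      using x0 by (simp add: K_def mult_ac add.commute)
    \<comment> \<open>Dividing by z leaves on the right only terms that are even in b, since z -> 1
      / z exchanges the two theta factors.\<close>
    hence "K * (theta z Q)\<^sup>2 * inverse z = theta (x * z) Q * theta (x / z) Q * (theta y Q)\<^sup>2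
       - theta (y * z) Q * theta (y / z) Q * (theta x Q)\<^sup>2"
      using z0 by (simp add: field_simps)
    thus "K * ((s b)\<^sup>2 * exp (- b)) = h a b * (s a')\<^sup>2 - h a' b * (s a)\<^sup>2"
      unfolding h_def s_def e ea exp_minus z_def[symmetric] by (simp add: mult_ac)
    show "((\<lambda>b. K * ((s b)\<^sup>2 * exp (- b))) has_field_derivative
        K * (2 * s b * u' b * exp (- b) - (s b)\<^sup>2 * exp (- b))) (at b)"
      using b by (auto intro!: derivative_eq_intros u(3) simp: C_def)
    show "((\<lambda>b. h a b * (s a')\<^sup>2 - h a' b * (s a)\<^sup>2) has_field_derivative
        h a b * l a b * (s a')\<^sup>2 - h a' b * l a' b * (s a)\<^sup>2) (at b)"
      by (intro DERIV_diff DERIV_cmult_right dh) (use b in \<open>auto simp: C_def\<close>)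
  next
    \<comment> \<open>The square of theta vanishes to second order at b = 0, so only 2 K (u' 0)^2
      survives, with (u' 0)^2 = (Q; Q)^4.\<close>
    have s0: "s 0 = 0" using theta_eq_one_minus_mult[OF Q(1), of 1] by (simp add: s_def)
    have "(s has_field_derivative u' 0) (at 0)" using u by blast
    thus "((\<lambda>b. K * (2 * s b * u' b * exp (- b) - (s b)\<^sup>2 * exp (- b))) has_field_derivative
        K * (2 * (poch Q Q) ^ 4)) (at 0)"
      by (auto intro!: derivative_eq_intros u2 simp: s0 u(4) eval_nat_numeral)
  next
    show "((\<lambda>b. h a b * l a b * (s a')\<^sup>2 - h a' b * l a' b * (s a)\<^sup>2) has_field_derivative
      - 2 * (s a)\<^sup>2 * P (exp a) * (s a')\<^sup>2 - (- 2 * (s a')\<^sup>2 * P (exp a')) * (s a)\<^sup>2) (at 0)"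
      by (intro DERIV_diff DERIV_cmult_right dh2 as)
  qed
  hence "2 * (K * (poch Q Q) ^ 4) = 2 * ((s a)\<^sup>2 * (s a')\<^sup>2 * (P (exp a') - P (exp a)))"
    by (simp add: algebra_simps)
  hence "K * (poch Q Q) ^ 4 = (s a)\<^sup>2 * (s a')\<^sup>2 * (P (exp a') - P (exp a))"
    by (simp only: mult_cancel_left) simp
  thus ?thesis by (simp add: K_def s_def P_def ea mult_ac)
qed

text \<open>For Q = x this is the sum of \<sigma>(n) x^n, the Eisenstein series of weight 2 up to
  its constant term and normalization.\<close>

definition lambert :: "complex \<Rightarrow> complex \<Rightarrow> complex" where
  "lambert x Q = (\<Sum>k. of_nat (Suc k) * x ^ Suc k / (1 - Q ^ Suc k))"

lemma summable_Suc_power: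
  fixes r :: real
  assumes "0 \<le> r" "r < 1"
  shows "summable (\<lambda>k. of_nat (Suc k) * r ^ Suc k)"
  using summable_mult[OF sums_summable[OF geometric_deriv_sums[of r]], of r] assms
  by (simp add: mult_ac)

text \<open>Expand u / (1 - u)^2 as the sum of k u^k at u = x Q^n and interchange the sums; the
  inner sum over n is then geometric.\<close>

lemma wpsum_eq_lambert:
  assumes x: "norm x < 1" and Q: "norm Q < 1"
  shows "summable (\<lambda>k. of_nat (Suc k) * x ^ Suc k / (1 - Q ^ Suc k))" "wpsum x Q = lambert x Q"
proof -
  define f where "f = (\<lambda>n k. of_nat (Suc k) * (x * Q ^ n) ^ Suc k)"
  \<comment> \<open>For positive exponents k, |Q|^(n k) <= |Q|^n. This separates the indices, so the
    majorant is a product of two convergent series.\<close>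
  have nf: "norm (f n k) \<le> norm Q ^ n * (of_nat (Suc k) * norm x ^ Suc k)" for n k
  proof -
    have "norm (f n k) = (norm Q ^ n) ^ Suc k * (of_nat (Suc k) * norm x ^ Suc k)"
      by (simp add: f_def norm_mult norm_power power_mult_distrib mult_ac del: of_nat_Suc power_Suc)
    also have "(norm Q ^ n) ^ Suc k \<le> norm Q ^ n"
      using Q power_decreasing[of 1 "Suc k" "norm Q ^ n"] by (simp add: power_le_one)
    finally show ?thesis by (simp add: mult_right_mono)
  qed
  have sQ: "(\<lambda>n. norm Q ^ n) summable_on UNIV"
    using Q by (simp add: summable_on_UNIV_nonneg_real_iff summable_geometric)
  have sx: "(\<lambda>k. of_nat (Suc k) * norm x ^ Suc k) summable_on UNIV"
    using summable_Suc_power[of "norm x"] x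
    by (subst summable_on_UNIV_nonneg_real_iff) (simp_all del: of_nat_Suc power_Suc)
  have g: "(\<lambda>p. norm ((\<lambda>(n, k). norm Q ^ n * (of_nat (Suc k) * norm x ^ Suc k)) p)) summable_on UNIV \<times> UNIV"
  proof (rule Infinite_Sum.abs_summable_on_Sigma_iff[THEN iffD2], intro conjI ballI)
    show "(\<lambda>k. norm (case (n, k) of (n, k) \<Rightarrow> norm Q ^ n * (of_nat (Suc k) * norm x ^ Suc k))) summable_on UNIV" for n
      using summable_on_cmult_right[OF sx, of "norm Q ^ n"] by (simp add: abs_mult del: of_nat_Suc power_Suc)
    show "(\<lambda>n. norm (\<Sum>\<^sub>\<infinity>k. norm (case (n, k) of (n, k) \<Rightarrow> norm Q ^ n * (of_nat (Suc k) * norm x ^ Suc k)))) summable_on UNIV"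
      using summable_on_cmult_left[OF sQ, of "\<bar>\<Sum>\<^sub>\<infinity>k. of_nat (Suc k) * norm x ^ Suc k\<bar>"]
      by (simp add: abs_mult infsum_cmult_right' del: of_nat_Suc power_Suc)
  qed
  have "(\<lambda>p. norm ((\<lambda>(n, k). f n k) p)) summable_on UNIV \<times> UNIV"
    by (rule Infinite_Sum.abs_summable_on_comparison_test[OF g])
      (use nf in \<open>auto simp del: of_nat_Suc power_Suc intro: order_trans[OF _ abs_ge_self]\<close>)
  hence F: "(\<lambda>(n, k). f n k) summable_on UNIV \<times> UNIV" by (rule abs_summable_summable)
  hence F': "(\<lambda>(k, n). f n k) summable_on UNIV \<times> UNIV"
    using summable_on_swap[of "\<lambda>(n, k). f n k" UNIV UNIV] by (simp add: o_def split_beta)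
  have row: "infsum (f n) UNIV = x * Q ^ n / (1 - x * Q ^ n)\<^sup>2" for n
  proof -
    have y: "norm (x * Q ^ n) < 1"
      using norm_mult_geometric_le'[OF order_refl Q, of x n] x by simp
    have "(\<lambda>k. (x * Q ^ n) * (of_nat (Suc k) * (x * Q ^ n) ^ k)) sums ((x * Q ^ n) * (1 / (1 - x * Q ^ n)\<^sup>2))"
      by (intro sums_mult geometric_deriv_sums y)
    hence "f n sums (x * Q ^ n / (1 - x * Q ^ n)\<^sup>2)"
      by (simp add: f_def[abs_def] mult_ac)
    moreover have "summable (\<lambda>k. norm (f n k))"
      using summable_Suc_power[of "norm (x * Q ^ n)"] y
      by (simp add: f_def norm_mult norm_power del: of_nat_Suc power_Suc)
    ultimately show ?thesis by (intro infsumI norm_summable_imp_has_sum)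
  qed
  have col: "infsum (\<lambda>n. f n k) UNIV = of_nat (Suc k) * x ^ Suc k / (1 - Q ^ Suc k)" for k
  proof -
    have q: "norm (Q ^ Suc k) < 1" using Q by (rule norm_power_less_one) simp
    have e: "f n k = of_nat (Suc k) * x ^ Suc k * (Q ^ Suc k) ^ n" for n
      by (simp add: f_def power_mult_distrib power_mult [symmetric] mult.commute del: of_nat_Suc power_Suc)
    have "(\<lambda>n. f n k) sums (of_nat (Suc k) * x ^ Suc k * (1 / (1 - Q ^ Suc k)))"
      unfolding e by (intro sums_mult geometric_sums q)
    moreover have "summable (\<lambda>n. norm (f n k))"
      unfolding e norm_mult[of "_ * _"] norm_power[of "Q ^ Suc k"]
      by (intro summable_mult summable_geometric) (use q in simp)
    ultimately show ?thesis by (simp add: infsumI norm_summable_imp_has_sum)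
  qed
  have "(\<lambda>k. infsum (\<lambda>n. f n k) UNIV) summable_on UNIV" "(\<lambda>n. infsum (f n) UNIV) summable_on UNIV"
    using summable_on_Sigma_banach[OF F'] summable_on_Sigma_banach[OF F] by simp_all
  hence s: "(\<lambda>k. of_nat (Suc k) * x ^ Suc k / (1 - Q ^ Suc k)) summable_on UNIV"
    "(\<lambda>n. x * Q ^ n / (1 - x * Q ^ n)\<^sup>2) summable_on UNIV"
    unfolding col row .
  thus "summable (\<lambda>k. of_nat (Suc k) * x ^ Suc k / (1 - Q ^ Suc k))"
    by (intro summable_on_imp_summable)
  have "(\<Sum>\<^sub>\<infinity>n. infsum (f n) UNIV) = (\<Sum>\<^sub>\<infinity>k. infsum (\<lambda>n. f n k) UNIV)"
    using infsum_swap_banach[OF F] .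
  moreover have "infsum a UNIV = suminf a" if "a summable_on UNIV" for a :: "nat \<Rightarrow> complex"
    by (rule sums_unique[OF has_sum_imp_sums[OF has_sum_infsum[OF that]]])
  ultimately show "wpsum x Q = lambert x Q"
    unfolding row col wpsum_def lambert_def using s by simp
qed

section \<open>The Riccati equation\<close>

text \<open>A distribution relation. In the expansion of u / (1 - u)^2 as the sum of k u^k, summing
  over u, w u, w^2 u keeps the k divisible by 3 with weight 3; the factor k = 3 m contributes
  another 3, hence the 9.\<close>

lemma wpsum_cube_roots:
  fixes x w :: complex
  assumes x: "norm x < 1" and Q: "norm Q < 1" and w: "w\<^sup>2 + w + 1 = 0"
  shows "wpsum x Q + wpsum (w * x) Q + wpsum (w\<^sup>2 * x) Q = 9 * wpsum (x ^ 3) (Q ^ 3)"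
proof -
  note W = cube_root_unity[OF w]
  define g where "g = (\<lambda>y::complex. y / (1 - y)\<^sup>2)"
  \<comment> \<open>The choice s = 0 makes the earlier lemma a statement about the constant
    y.\<close>
  have summable: "(\<lambda>n. g (y * R ^ n)) sums wpsum y R" if "norm y < 1" "norm R < 1" for y R
    using geometric_logderiv_series_derivative(3)[of R y 0 0] that
    by (simp add: wpsum_def g_def summable_sums)
  have g3: "g y + g (w * y) + g (w\<^sup>2 * y) = 9 * g (y ^ 3)" if "norm y < 1" for y
  proof -
    have ne: "1 - y \<noteq> 0" "1 - w * y \<noteq> 0" "1 - w\<^sup>2 * y \<noteq> 0"
    proof -
      have "1 - u \<noteq> 0" if "norm u < 1" for u :: complex using that by auto
      thus "1 - y \<noteq> 0" "1 - w * y \<noteq> 0" "1 - w\<^sup>2 * y \<noteq> 0"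
        using that W(5) by (simp_all add: norm_mult norm_power)
    qed
    have Wl: "w * (w * u) = - (w * u) - u" for u
    proof -
      have "w * (w * u) = (w * w) * u" by (simp only: mult.assoc)
      thus ?thesis unfolding W(2) by (simp add: algebra_simps)
    qed
    define a b c where "a = 1 - y" and "b = 1 - w * y" and "c = 1 - w\<^sup>2 * y"
    have abc: "a * b * c = 1 - y ^ 3"
    proof -
      have "a * b * c = 1 - (w\<^sup>2 + w + 1) * y + w * (w\<^sup>2 + w + 1) * y\<^sup>2 - w ^ 3 * y ^ 3"
        by (simp add: a_def b_def c_def algebra_simps power2_eq_square power3_eq_cube)
      thus ?thesis using w W(3) by simp
    qed
    have num: "y * (b * c)\<^sup>2 + w * y * (a * c)\<^sup>2 + w\<^sup>2 * y * (a * b)\<^sup>2 = 9 * y ^ 3"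
    proof -
      have p: "b * c = 1 + y + y\<^sup>2" "a * c = 1 + w * y + w\<^sup>2 * y\<^sup>2" "a * b = 1 + w\<^sup>2 * y + w * y\<^sup>2"
        by (simp_all add: a_def b_def c_def algebra_simps power2_eq_square W(2) Wl)
      show ?thesis unfolding p by (simp add: algebra_simps eval_nat_numeral W(2) Wl)
    qed
    have "g y + g (w * y) + g (w\<^sup>2 * y) = (y * (b * c)\<^sup>2 + w * y * (a * c)\<^sup>2 + w\<^sup>2 * y * (a * b)\<^sup>2) / (a * b * c)\<^sup>2"
      using ne by (simp add: g_def a_def[symmetric] b_def[symmetric] c_def[symmetric] divide_simps power_mult_distrib)
        (simp add: algebra_simps)
    thus ?thesis unfolding num abc by (simp add: g_def)
  qed
  have "(\<lambda>n. g (x * Q ^ n) + g (w * x * Q ^ n) + g (w\<^sup>2 * x * Q ^ n)) sums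
      (wpsum x Q + wpsum (w * x) Q + wpsum (w\<^sup>2 * x) Q)"
    by (intro sums_add summable) (use x Q W(5) in \<open>auto simp: norm_mult norm_power\<close>)
  also have "(\<lambda>n. g (x * Q ^ n) + g (w * x * Q ^ n) + g (w\<^sup>2 * x * Q ^ n)) = (\<lambda>n. 9 * g (x ^ 3 * (Q ^ 3) ^ n))"
  proof
    fix n
    have "norm (x * Q ^ n) < 1" using norm_mult_geometric_le'[OF order_refl Q, of x n] x by simp
    moreover have "(Q ^ 3) ^ n = (Q ^ n) ^ 3" by (simp add: power_mult [symmetric] mult.commute)
    ultimately show "g (x * Q ^ n) + g (w * x * Q ^ n) + g (w\<^sup>2 * x * Q ^ n) = 9 * g (x ^ 3 * (Q ^ 3) ^ n)"
      using g3[of "x * Q ^ n"] by (simp add: mult.assoc power_mult_distrib)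
  qed
  finally have "(\<lambda>n. 9 * g (x ^ 3 * (Q ^ 3) ^ n)) sums (wpsum x Q + wpsum (w * x) Q + wpsum (w\<^sup>2 * x) Q)" .
  moreover have "(\<lambda>n. 9 * g (x ^ 3 * (Q ^ 3) ^ n)) sums (9 * wpsum (x ^ 3) (Q ^ 3))"
    by (intro sums_mult summable norm_power_less_one x Q) simp_all
  ultimately show ?thesis by (rule sums_unique2)
qed

text \<open>Termwise, y / (1 - y^2) = y / (1 - y) - y^2 / (1 - y^2) with y = x^k.\<close>

lemma lambert_square:
  assumes x: "norm x < 1"
  shows "lambert x (x\<^sup>2) = lambert x x - lambert (x\<^sup>2) (x\<^sup>2)"
proof -
  have x2: "norm (x\<^sup>2) < 1" using x by (rule norm_power_less_one) simp
  have "(\<lambda>k. of_nat (Suc k) * x ^ Suc k / (1 - x ^ Suc k)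
      - of_nat (Suc k) * (x\<^sup>2) ^ Suc k / (1 - (x\<^sup>2) ^ Suc k)) sums (lambert x x - lambert (x\<^sup>2) (x\<^sup>2))"
    unfolding lambert_def by (intro sums_diff summable_sums wpsum_eq_lambert x x2)
  also have "(\<lambda>k. of_nat (Suc k) * x ^ Suc k / (1 - x ^ Suc k)
      - of_nat (Suc k) * (x\<^sup>2) ^ Suc k / (1 - (x\<^sup>2) ^ Suc k))
      = (\<lambda>k. of_nat (Suc k) * x ^ Suc k / (1 - (x\<^sup>2) ^ Suc k))"
  proof
    fix k
    define y m where "y = x ^ Suc k" and "m = (of_nat (Suc k) :: complex)"
    have y2: "(x\<^sup>2) ^ Suc k = y\<^sup>2" unfolding y_def power_mult[symmetric] by (simp only: mult.commute)
    have "1 - y \<noteq> 0" "1 - y\<^sup>2 \<noteq> 0"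
      using one_minus_power_nonzero[OF x, of "Suc k"] one_minus_power_nonzero[OF x2, of "Suc k"]
      unfolding y2 y_def by simp_all
    moreover have "1 - y\<^sup>2 = (1 - y) * (1 + y)" by (simp add: algebra_simps power2_eq_square)
    ultimately have "m * y / (1 - y) - m * y\<^sup>2 / (1 - y\<^sup>2) = m * y / (1 - y\<^sup>2)"
      by (simp add: divide_simps) (simp add: algebra_simps power2_eq_square)
    thus "of_nat (Suc k) * x ^ Suc k / (1 - x ^ Suc k)
      - of_nat (Suc k) * (x\<^sup>2) ^ Suc k / (1 - (x\<^sup>2) ^ Suc k) = of_nat (Suc k) * x ^ Suc k / (1 - (x\<^sup>2) ^ Suc k)"
      unfolding y2 y_def[symmetric] m_def[symmetric] .
  qed
  finally show ?thesis by (simp add: lambert_def sums_iff)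
qed

text \<open>The theta formula for Weierstrass differences at w q and q with base q^2; both have norm
  |q|, strictly between |q|^2 and 1. The difference is 2 S - (9 S' - S) = 3 (S - 3 S'), where S and
  S' are \<open>wpsum\<close> at (q, q^2) and (q^3, q^6).\<close>

lemma level6_lambert_identity:
  fixes q w :: complex
  assumes q: "norm q < 1" "q \<noteq> 0" and w: "w\<^sup>2 + w + 1 = 0"
  defines "E1 \<equiv> poch q q" and "E2 \<equiv> poch (q\<^sup>2) (q\<^sup>2)" and "E3 \<equiv> poch (q ^ 3) (q ^ 3)"
    and "E6 \<equiv> poch (q ^ 6) (q ^ 6)"
  shows "lambert q q - lambert (q\<^sup>2) (q\<^sup>2) - 3 * lambert (q ^ 3) (q ^ 3) + 3 * lambert (q ^ 6) (q ^ 6)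
       = q * E2 ^ 4 * E6 ^ 4 / (E1\<^sup>2 * E3\<^sup>2)" (is "?T = _")
proof -
  note W = cube_root_unity[OF w] and nz = E_nonzero[OF q, folded E1_def E2_def E3_def E6_def]
  note q2 = norm_q_powers(1)[OF q] and q3 = norm_q_powers(2)[OF q]
  have nq: "norm (q\<^sup>2) < norm q" using mult_strict_right_mono[of "norm q" 1 "norm q"] q by (simp add: norm_mult power2_eq_square)
  have "wpsum q (q\<^sup>2) = lambert q q - lambert (q\<^sup>2) (q\<^sup>2)"
    using wpsum_eq_lambert(2)[OF q(1) q2] lambert_square[OF q(1)] by simp
  moreover have "wpsum (q ^ 3) ((q\<^sup>2) ^ 3) = lambert (q ^ 3) (q ^ 3) - lambert (q ^ 6) (q ^ 6)"
    using wpsum_eq_lambert(2)[OF q3 norm_power_less_one[OF q3, of 2]] lambert_square[OF q3]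
    by (simp flip: power_mult)
  ultimately have T: "wpsum q (q\<^sup>2) - 3 * wpsum (q ^ 3) ((q\<^sup>2) ^ 3) = ?T" by simp
  have d: "q\<^sup>2 / q = q" "q\<^sup>2 / (w * q) = w\<^sup>2 * q"
  proof -
    show "q\<^sup>2 / q = q" using q by (simp add: power2_eq_square)
    have "q\<^sup>2 / (w * q) = (1 / w) * q" using q by (simp add: power2_eq_square)
    thus "q\<^sup>2 / (w * q) = w\<^sup>2 * q" unfolding W(6) .
  qed
  have "q * E2 ^ 4 * (theta (w * q * q) (q\<^sup>2) * theta (w * q / q) (q\<^sup>2))
     = (theta (w * q) (q\<^sup>2))\<^sup>2 * (theta q (q\<^sup>2))\<^sup>2 *
       ((wpsum q (q\<^sup>2) + wpsum q (q\<^sup>2)) - (wpsum (w * q) (q\<^sup>2) + wpsum (w\<^sup>2 * q) (q\<^sup>2)))"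
    using wpsum_difference[OF q2, of "w * q" q] q nq W(5) unfolding d E2_def by (simp add: norm_mult)
  also have "(wpsum q (q\<^sup>2) + wpsum q (q\<^sup>2)) - (wpsum (w * q) (q\<^sup>2) + wpsum (w\<^sup>2 * q) (q\<^sup>2)) = 3 * ?T"
    using wpsum_cube_roots[OF q(1) q2 w] unfolding T[symmetric] by (simp add: algebra_simps)
  also have "theta (w * q) (q\<^sup>2) = E2 * E3 / (E1 * E6)"
    using theta2_wq[OF q w] by (simp add: E1_def E2_def E3_def E6_def)
  also have "theta q (q\<^sup>2) = (E1 / E2)\<^sup>2"
    using theta2_q[OF q] by (simp add: E1_def E2_def)
  also have "theta (w * q * q) (q\<^sup>2) * theta (w * q / q) (q\<^sup>2) = 3 * (E6 / E2)\<^sup>2"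
    using theta2_product_wq_q[OF q w] by (simp add: E2_def E6_def)
  finally have "3 * (q * E2 ^ 4 * (E6 / E2)\<^sup>2) = 3 * ((E2 * E3 / (E1 * E6))\<^sup>2 * ((E1 / E2)\<^sup>2)\<^sup>2 * ?T)"
    by (simp only: mult_ac)
  hence *: "q * E2 ^ 4 * (E6 / E2)\<^sup>2 = (E2 * E3 / (E1 * E6))\<^sup>2 * ((E1 / E2)\<^sup>2)\<^sup>2 * ?T" by simp
  have "T = q * E2 ^ 4 * E6 ^ 4 / (E1\<^sup>2 * E3\<^sup>2)"
    if "q * E2 ^ 4 * (E6 / E2)\<^sup>2 = (E2 * E3 / (E1 * E6))\<^sup>2 * ((E1 / E2)\<^sup>2)\<^sup>2 * T" for T
    using that nz by (simp add: field_simps eval_nat_numeral)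
  from this[OF *] show ?thesis .
qed

section \<open>Infinite products and theta constants as functions of tau\<close>

lemma exp_two_pi_i_norm:
  assumes "Im t > 0"
  shows "norm (exp (2 * of_real pi * \<i> * t)) < 1"
  using assms by (simp add: mult_pos_pos)

lemma qpoch_inf_exp_has_derivative:
  assumes t: "Im t > 0" and k: "k > 0"
  defines "q \<equiv> exp (2 * of_real pi * \<i> * t)"
  shows "((\<lambda>t. qpoch_inf (exp (2 * of_real pi * \<i> * t)) k) has_field_derivative
      qpoch_inf q k * (- (2 * of_real pi * \<i>) * (of_nat k * lambert (q ^ k) (q ^ k)))) (at t)"
proof -
  define e where "e = (\<lambda>t. exp (2 * of_real pi * \<i> * t))"
  \<comment> \<open>On the half-plane above half the height of t, |q| stays below the fixed radius
    \<open>r\<close>, which yields the uniform majorant.\<close>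
  define c where "c = Im t / 2"
  define r where "r = exp (- (2 * pi * c))"
  have r: "0 < r" "r < 1" using t by (simp_all add: r_def c_def)
  have ne: "norm (e x) = exp (- (2 * pi * Im x))" for x by (simp add: e_def)
  have q: "norm q < 1" unfolding q_def by (rule exp_two_pi_i_norm[OF t])
  have pw: "e x ^ (k * Suc n) = exp (of_nat (k * Suc n) * (2 * of_real pi * \<i> * x))" for x n
    unfolding e_def by (rule exp_of_nat_mult[symmetric])
  obtain L where L: "(\<lambda>n. - (2 * of_real pi * \<i> * (of_nat k * of_nat (Suc n)) * e t ^ (k * Suc n)) / (1 - e t ^ (k * Suc n))) sums L"
    "((\<lambda>x. \<Prod>n. 1 - e x ^ (k * Suc n)) has_field_derivative (\<Prod>n. 1 - e t ^ (k * Suc n)) * L) (at t)"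
  proof (rule has_field_derivative_prodinf[of "{x. Im x > c}" t "\<lambda>n x. e x ^ (k * Suc n)"
        "\<lambda>n x. 2 * of_real pi * \<i> * (of_nat k * of_nat (Suc n)) * e x ^ (k * Suc n)" "\<lambda>n. r * r ^ n"])
    show "open {x. Im x > c}" by (intro open_Collect_less continuous_intros)
    show "t \<in> {x. Im x > c}" using t by (simp add: c_def)
    show "((\<lambda>x. e x ^ (k * Suc n)) has_field_derivative
        2 * of_real pi * \<i> * (of_nat k * of_nat (Suc n)) * e x ^ (k * Suc n)) (at x)" for n x
      unfolding pw by (auto intro!: derivative_eq_intros simp: algebra_simps)
    show b: "norm (e x ^ (k * Suc n)) \<le> r * r ^ n" if "x \<in> {x. Im x > c}" for n x
    proof -
      have "norm (e x) \<le> r" unfolding ne r_def using that by simp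
      hence "norm (e x ^ (k * Suc n)) \<le> r ^ (k * Suc n)"
        unfolding norm_power by (intro power_mono) auto
      also have "Suc n \<le> k * Suc n" using k by (cases k) auto
      hence "r ^ (k * Suc n) \<le> r ^ Suc n" using r by (intro power_decreasing) auto
      finally show ?thesis by simp
    qed
    show "summable (\<lambda>n. r * r ^ n)" using r by (intro summable_mult summable_geometric) auto
    show "e x ^ (k * Suc n) \<noteq> 1" if "x \<in> {x. Im x > c}" for n x
    proof -
      have "Im x > 0" using that t by (simp add: c_def)
      hence "norm (e x) < 1" unfolding e_def by (rule exp_two_pi_i_norm)
      thus ?thesis using one_minus_power_nonzero[of "e x" "k * Suc n"] k by auto
    qed
  qed (use that in blast)
  have qk: "norm (q ^ k) < 1" using norm_power_less_one[OF q k] .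
  have "(\<lambda>n. - (2 * of_real pi * \<i>) * (of_nat k * (of_nat (Suc n) * (q ^ k) ^ Suc n / (1 - (q ^ k) ^ Suc n)))) sums
      (- (2 * of_real pi * \<i>) * (of_nat k * lambert (q ^ k) (q ^ k)))"
    unfolding lambert_def by (intro sums_mult summable_sums wpsum_eq_lambert qk)
  moreover have et: "e t = q" by (simp add: e_def q_def)
  note L(1)[unfolded et power_mult]
  moreover have "- (2 * of_real pi * \<i> * (of_nat k * of_nat (Suc n)) * X) / (1 - X)
      = - (2 * of_real pi * \<i>) * (of_nat k * (of_nat (Suc n) * X / (1 - X)))" for n and X :: complex
    by (simp add: mult_ac del: of_nat_Suc)
  ultimately have "L = - (2 * of_real pi * \<i>) * (of_nat k * lambert (q ^ k) (q ^ k))"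
    by (simp only: sums_unique2)
  with L(2) et show ?thesis by (simp add: qpoch_inf_def e_def)
qed

text \<open>Derivatives are carried as value times logarithmic derivative, so for a quotient of
  products these add up with the exponents as weights.\<close>

lemma has_logderiv_mult:
  fixes f g :: "complex \<Rightarrow> complex"
  assumes "(f has_field_derivative f z * a) (at z)" "(g has_field_derivative g z * b) (at z)"
  shows "((\<lambda>z. f z * g z) has_field_derivative (f z * g z) * (a + b)) (at z)"
  using DERIV_mult[OF assms] by (simp add: algebra_simps)

lemma has_logderiv_divide:
  fixes f g :: "complex \<Rightarrow> complex"
  assumes "(f has_field_derivative f z * a) (at z)" "(g has_field_derivative g z * b) (at z)" "g z \<noteq> 0"
  shows "((\<lambda>z. f z / g z) has_field_derivative (f z / g z) * (a - b)) (at z)"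
proof -
  have "(f z * a * g z - f z * (g z * b)) / (g z * g z) = f z / g z * (a - b)"
    using assms(3) by (simp add: divide_simps) (simp add: algebra_simps)
  thus ?thesis using DERIV_divide[OF assms] by (simp only:)
qed

lemma has_logderiv_power:
  fixes f :: "complex \<Rightarrow> complex"
  assumes "(f has_field_derivative f z * a) (at z)"
  shows "((\<lambda>z. f z ^ n) has_field_derivative f z ^ n * (of_nat n * a)) (at z)"
proof (cases n)
  case (Suc m)
  thus ?thesis using DERIV_power[OF assms, of n] by (simp add: mult_ac)
qed simp

text \<open>Half of (n + 1/2)^2 is \<open>tri (- n)\<close> + 1/8, so after n -> - n the series is a
  theta series with two exponential factors in front. The sign in the argument cancels the one in
  \<open>theta_term\<close>.\<close>

lemma theta_char_eq_theta:
  assumes t: "Im t > 0"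
  defines "q \<equiv> exp (2 * of_real pi * \<i> * t)"
  shows "theta_char 1 e' 0 t = exp (of_real pi * \<i> * t / 4) * exp (of_real pi * \<i> * of_real e' / 2)
     * (poch q q * theta (- exp (- (of_real pi * \<i> * of_real e'))) q)"
proof -
  define p where "p = exp (of_real pi * \<i> * t / 4) * exp (of_real pi * \<i> * of_real e' / 2)"
  define x where "x = - exp (- (of_real pi * \<i> * of_real e'))"
  have q: "norm q < 1" "q \<noteq> 0" using exp_two_pi_i_norm[OF t] by (simp_all add: q_def)
  have x: "x \<noteq> 0" by (simp add: x_def)
  have "theta_char 1 e' 0 t = (\<Sum>\<^sub>\<infinity>n::int. p * theta_term x q (- n))"
    unfolding theta_char_def
  proof (rule infsum_cong)
    fix n :: int
    have "2 * (of_int (tri (- n)) :: complex) = of_int n * (of_int n + 1)"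
    proof -
      have "2 * tri (- n) = n * (n + 1)" unfolding two_tri by (simp add: algebra_simps)
      thus ?thesis by (metis of_int_1 of_int_add of_int_mult of_int_numeral)
    qed
    hence tri: "(of_int (tri (- n)) :: complex) = of_int n * (of_int n + 1) / 2" by (simp add: field_simps)
    have "p * theta_term x q (- n) = exp (of_real pi * \<i> * t / 4 + of_real pi * \<i> * of_real e' / 2
        + of_int (- n) * (- (of_real pi * \<i> * of_real e')) + of_int (tri (- n)) * (2 * of_real pi * \<i> * t))"
      unfolding p_def theta_term_def x_def q_def minus_minus exp_add exp_power_int by (simp add: mult_ac)
    also have "\<dots> = exp (2 * of_real pi * \<i> *
        ((1/2) * (of_int n + of_real (1/2))\<^sup>2 * t + (of_int n + of_real (1/2)) * (0 + of_real (e'/2))))"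
      unfolding tri by (rule arg_cong[of _ _ exp]) (simp add: field_simps power2_eq_square)
    finally show "exp (2 * of_real pi * \<i> *
        ((1/2) * (of_int n + of_real (1/2))\<^sup>2 * t + (of_int n + of_real (1/2)) * (0 + of_real (e'/2))))
        = p * theta_term x q (- n)" by simp
  qed
  also have "\<dots> = p * (\<Sum>\<^sub>\<infinity>n::int. theta_term x q (- n))" by (rule infsum_cmult_right')
  also have "(\<Sum>\<^sub>\<infinity>n::int. theta_term x q (- n)) = infsum (theta_term x q) UNIV"
    by (rule infsum_reindex_bij_witness[of _ uminus uminus]) auto
  also have "\<dots> = poch q q * theta x q" by (rule theta_term_infsum[OF q x])
  finally show ?thesis by (simp add: p_def x_def)
qed

lemma exp_cube_root_unity:
  defines "w \<equiv> exp (2 * of_real pi * \<i> / 3)"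
  shows "w\<^sup>2 + w + 1 = 0"
proof -
  have "w ^ 3 = exp (of_nat 3 * (2 * of_real pi * \<i> / 3))" unfolding w_def by (rule exp_of_nat_mult[symmetric])
  also have "of_nat 3 * (2 * of_real pi * \<i> / 3) = 2 * of_real pi * \<i>" by simp
  finally have w3: "w ^ 3 = 1" unfolding exp_two_pi_i .
  have "Im w = sin (2 * pi / 3)" by (simp add: w_def Im_exp)
  moreover have "sin (2 * pi / 3) > 0" by (rule sin_gt_zero) (use pi_gt_zero in auto)
  ultimately have "w \<noteq> 1" by auto
  moreover have "(w - 1) * (w\<^sup>2 + w + 1) = w ^ 3 - 1" by (simp add: algebra_simps eval_nat_numeral)
  ultimately show ?thesis using w3 by simp
qed

text \<open>The characteristics 1/3 and 2/3 give the arguments w and - w^2 for w = exp (2 pi i / 3).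
  All roots of unity cancel in the fourth powers: (1 - w)^4 = 9 w^2 stands over w times w^4 = w^2,
  which leaves 9.\<close>

lemma theta_char_ratio:
  assumes t: "Im t > 0"
  defines "q \<equiv> exp (2 * of_real pi * \<i> * t)"
  shows "theta_char 1 (1/3) 0 t ^ 4 / theta_char 1 (2/3) 0 t ^ 4
       = 9 * (qpoch_inf q 2 * (qpoch_inf q 3)\<^sup>2 / ((qpoch_inf q 1)\<^sup>2 * qpoch_inf q 6)) ^ 4"
proof -
  have q: "norm q < 1" "q \<noteq> 0" using exp_two_pi_i_norm[OF t] by (simp_all add: q_def)
  define w where "w = exp (2 * of_real pi * \<i> / 3)"
  have w: "w\<^sup>2 + w + 1 = 0" using exp_cube_root_unity by (simp add: w_def)
  note W = cube_root_unity[OF w] and nz = E_nonzero[OF q]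
  have w4: "w ^ 4 = w" using W(3) by (simp add: eval_nat_numeral)
  have x1: "- exp (- (of_real pi * \<i> * of_real (1/3))) = w"
  proof -
    have "w = exp (of_real pi * \<i>) * exp (- (of_real pi * \<i> * of_real (1/3)))"
      unfolding w_def exp_add[symmetric] by (rule arg_cong[of _ _ exp]) (simp add: field_simps)
    thus ?thesis by simp
  qed
  have x2: "- exp (- (of_real pi * \<i> * of_real (2/3))) = - (w\<^sup>2)"
  proof -
    have arg: "of_real pi * \<i> * of_real (2/3) = 2 * of_real pi * \<i> / 3" by simp
    have inv: "inverse w = w\<^sup>2" using W(6) by (simp add: divide_inverse)
    show ?thesis unfolding arg exp_minus w_def[symmetric] inv ..
  qed
  define p where "p = exp (of_real pi * \<i> * t / 4)"
  define p1 where "p1 = exp (of_real pi * \<i> * of_real (1/3) / 2)"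
  define p2 where "p2 = exp (of_real pi * \<i> * of_real (2/3) / 2)"
  have pn: "p \<noteq> 0" "p1 \<noteq> 0" "p2 \<noteq> 0" by (simp_all add: p_def p1_def p2_def)
  \<comment> \<open>The quotient of the two prefactors is exp (pi i / 6); its fourth power is
    w.\<close>
  have p4: "p2 ^ 4 = w * p1 ^ 4"
  proof -
    have "p1 ^ 4 = exp (of_nat 4 * (of_real pi * \<i> * of_real (1/3) / 2))"
      "p2 ^ 4 = exp (of_nat 4 * (of_real pi * \<i> * of_real (2/3) / 2))"
      unfolding p1_def p2_def by (rule exp_of_nat_mult[symmetric])+
    thus ?thesis unfolding w_def by (simp only: exp_add[symmetric])
        (rule arg_cong[of _ _ exp], simp add: field_simps)
  qed
  have "(1 - w) ^ 4 = 9 * w\<^sup>2"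
  proof -
    have "(1 - w)\<^sup>2 = - 3 * w" using W(1) by (simp add: power2_diff)
    hence "((1 - w)\<^sup>2)\<^sup>2 = 9 * w\<^sup>2" by (simp add: power_mult_distrib)
    thus ?thesis by (simp flip: power_mult)
  qed
  define E1 E2 E3 E6 where "E1 = poch q q" and "E2 = poch (q\<^sup>2) (q\<^sup>2)"
    and "E3 = poch (q ^ 3) (q ^ 3)" and "E6 = poch (q ^ 6) (q ^ 6)"
  note nzE = nz[folded E1_def E2_def E3_def E6_def]
  have "theta_char 1 (1/3) 0 t = p * p1 * (E1 * ((1 - w) * (E3 / E1)))"
    using theta_char_eq_theta[OF t, of "1/3"] theta_cube_root[OF q w]
    unfolding x1 by (simp add: p_def p1_def q_def[symmetric] E1_def E3_def)
  hence a: "theta_char 1 (1/3) 0 t ^ 4 = p ^ 4 * p1 ^ 4 * (9 * w\<^sup>2) * E3 ^ 4"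
    using nzE by (simp add: power_mult_distrib \<open>(1 - w) ^ 4 = _\<close>)
  have "theta_char 1 (2/3) 0 t = p * p2 * (E1 * (- w * (E1 * E6 / (E2 * E3))))"
    using theta_char_eq_theta[OF t, of "2/3"] theta_sixth_root[OF q w]
    unfolding x2 by (simp add: p_def p2_def q_def[symmetric] E1_def E2_def E3_def E6_def)
  hence "theta_char 1 (2/3) 0 t ^ 4 = p ^ 4 * p2 ^ 4 * w ^ 4 * (E1 * (E1 * E6 / (E2 * E3))) ^ 4"
    by (simp add: power_mult_distrib power_divide)
  hence b: "theta_char 1 (2/3) 0 t ^ 4 = p ^ 4 * p1 ^ 4 * w\<^sup>2 * (E1\<^sup>2 * E6 / (E2 * E3)) ^ 4"
    unfolding p4 w4 by (simp add: power2_eq_square mult_ac)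
  have c: "qpoch_inf q 1 = E1" "qpoch_inf q 2 = E2" "qpoch_inf q 3 = E3" "qpoch_inf q 6 = E6"
    by (simp_all add: qpoch_inf_eq_poch E1_def E2_def E3_def E6_def)
  show ?thesis
    unfolding a b c using pn W(4) nzE by (simp add: field_simps eval_nat_numeral)
qed

theorem mainTheorem9:
  fixes \<tau> :: complex
  assumes "Im \<tau> > 0"
  defines "q \<equiv> exp (2 * of_real pi * \<i> * \<tau>)"
  defines "W \<equiv> (\<lambda>t. theta_char 1 (1/3) 0 t ^ 4 / theta_char 1 (2/3) 0 t ^ 4)"
  shows "W \<tau> = (of_real (sqrt 3) * qpoch_inf q 2 * (qpoch_inf q 3)\<^sup>2
                   / ((qpoch_inf q 1)\<^sup>2 * qpoch_inf q 6)) ^ 4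
       \<and> (W has_field_derivative
            (2 * of_real pi * \<i> *
              ((1 / 2^3) * (((qpoch_inf q 1)\<^sup>2 * (qpoch_inf q 3)\<^sup>2
                              / (qpoch_inf q 2 * qpoch_inf q 6)))\<^sup>2
               * ((W \<tau>)\<^sup>2 - 10 * W \<tau> + 9)))) (at \<tau>)"
proof
  have q: "norm q < 1" "q \<noteq> 0" using exp_two_pi_i_norm[OF assms(1)] by (simp_all add: q_def)
  obtain w :: complex where w: "w\<^sup>2 + w + 1 = 0" using exp_cube_root_unity by blast
  define e where "e = (\<lambda>k t. qpoch_inf (exp (2 * of_real pi * \<i> * t)) k)"
  define F where "F = (\<lambda>t. (e 2 t * (e 3 t)\<^sup>2 / ((e 1 t)\<^sup>2 * e 6 t)) ^ 4)"
  define E1 E2 E3 E6 where "E1 = poch q q" and "E2 = poch (q\<^sup>2) (q\<^sup>2)"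
    and "E3 = poch (q ^ 3) (q ^ 3)" and "E6 = poch (q ^ 6) (q ^ 6)"
  have c: "qpoch_inf q 1 = E1" "qpoch_inf q 2 = E2" "qpoch_inf q 3 = E3" "qpoch_inf q 6 = E6"
    by (simp_all add: qpoch_inf_eq_poch E1_def E2_def E3_def E6_def)
  have e: "e k \<tau> = qpoch_inf q k" for k by (simp add: e_def q_def)
  note nz = E_nonzero[OF q, folded E1_def E2_def E3_def E6_def]
  have WF: "9 * F t = W t" if "Im t > 0" for t
    using theta_char_ratio[OF that] by (simp add: W_def F_def e_def)
  have WE: "W \<tau> = 9 * (E2 * E3\<^sup>2 / (E1\<^sup>2 * E6)) ^ 4"
    using WF[OF assms(1)] unfolding F_def e c by simp
  have "(complex_of_real (sqrt 3)) ^ 4 = 9"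
  proof -
    have "sqrt 3 ^ (2 * 2) = 9" unfolding power_mult by simp
    hence "sqrt 3 ^ 4 = 9" by simp
    thus ?thesis by (metis of_real_numeral of_real_power)
  qed
  thus "W \<tau> = (of_real (sqrt 3) * qpoch_inf q 2 * (qpoch_inf q 3)\<^sup>2
                   / ((qpoch_inf q 1)\<^sup>2 * qpoch_inf q 6)) ^ 4"
    unfolding c WE by (simp add: power_mult_distrib power_divide)
  define l where "l = (\<lambda>k. lambert (q ^ k) (q ^ k))"
  define d where "d = (\<lambda>k. - (2 * of_real pi * \<i>) * (of_nat k * l k))"
  have de: "(e k has_field_derivative e k \<tau> * d k) (at \<tau>)" if "k > 0" for k
    using qpoch_inf_exp_has_derivative[OF assms(1) that] by (simp add: e_def d_def l_def q_def)
  have "(F has_field_derivative F \<tau> * (of_nat 4 * ((d 2 + of_nat 2 * d 3) - (of_nat 2 * d 1 + d 6)))) (at \<tau>)"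
    unfolding F_def
    by (intro has_logderiv_power has_logderiv_divide has_logderiv_mult de)
      (use nz in \<open>simp_all add: e c c(1)[unfolded One_nat_def]\<close>)
  hence "((\<lambda>t. 9 * F t) has_field_derivative
      9 * (F \<tau> * (of_nat 4 * ((d 2 + of_nat 2 * d 3) - (of_nat 2 * d 1 + d 6))))) (at \<tau>)"
    by (rule DERIV_cmult)
  \<comment> \<open>The product formula for W holds on the open upper half-plane only, which is
    enough for the derivative at a point.\<close>
  hence D: "(W has_field_derivative
      9 * (F \<tau> * (of_nat 4 * ((d 2 + of_nat 2 * d 3) - (of_nat 2 * d 1 + d 6))))) (at \<tau>)"
    by (rule has_field_derivative_transform_within_open[of _ _ _ "{t. Im t > 0}"])
      (use assms(1) WF in \<open>auto intro!: open_Collect_less continuous_intros\<close>)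
  have T: "l 1 - l 2 - 3 * l 3 + 3 * l 6 = q * E2 ^ 4 * E6 ^ 4 / (E1\<^sup>2 * E3\<^sup>2)"
    using level6_lambert_identity[OF q w] by (simp add: l_def E1_def E2_def E3_def E6_def)
  \<comment> \<open>The weight of each Lambert series is minus the index k times the exponent of E_k
    in W. The exponents -8, 4, 8, -4 for k = 1, 2, 3, 6 give 8, -8, -24, 24.\<close>
  have "9 * (F \<tau> * (of_nat 4 * ((d 2 + of_nat 2 * d 3) - (of_nat 2 * d 1 + d 6))))
      = 9 * F \<tau> * (2 * of_real pi * \<i>) * (8 * (l 1 - l 2 - 3 * l 3 + 3 * l 6))"
    by (simp add: d_def algebra_simps)
  also have "\<dots> = 2 * of_real pi * \<i> * (8 * (q * E2 ^ 4 * E6 ^ 4 / (E1\<^sup>2 * E3\<^sup>2)) * W \<tau>)"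
    unfolding T WF[OF assms(1)] by (simp add: mult_ac)
  also have "8 * (q * E2 ^ 4 * E6 ^ 4 / (E1\<^sup>2 * E3\<^sup>2)) * W \<tau>
      = 1 / 2 ^ 3 * (E1\<^sup>2 * E3\<^sup>2 / (E2 * E6))\<^sup>2 * ((W \<tau>)\<^sup>2 - 10 * W \<tau> + 9)"
    unfolding WE
    by (rule level6_Riccati_algebra[OF q(2) nz])
      (use level6_identity_roots_of_unity[OF q w] level6_identity_powers_of_q[OF q]
       in \<open>simp_all add: E1_def E2_def E3_def E6_def\<close>)
  finally have deriv_eq: "9 * (F \<tau> * (of_nat 4 * ((d 2 + of_nat 2 * d 3) - (of_nat 2 * d 1 + d 6))))
      = 2 * of_real pi * \<i> * (1 / 2 ^ 3 * (E1\<^sup>2 * E3\<^sup>2 / (E2 * E6))\<^sup>2 * ((W \<tau>)\<^sup>2 - 10 * W \<tau> + 9))" .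
  show "(W has_field_derivative
            (2 * of_real pi * \<i> *
              ((1 / 2^3) * (((qpoch_inf q 1)\<^sup>2 * (qpoch_inf q 3)\<^sup>2
                              / (qpoch_inf q 2 * qpoch_inf q 6)))\<^sup>2
               * ((W \<tau>)\<^sup>2 - 10 * W \<tau> + 9)))) (at \<tau>)"
    using D unfolding c deriv_eq .
qed

end
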